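(* Let $\mathbf{F}$ be a singular LICM matrix-valued function, and let $\mathrm{D}_{\mathbf{F}}$ and $\mathrm{J}_{\mathbf{F}}$ be the associated $\mathbf{F}$-derivative and $\mathbf{F}$-integral operators. Then the following relations hold: $$\mathrm{J}_{\mathbf{F}}\,\mathrm{D}_{\mathbf{F}}\,\mathbf{w}(t)=\mathbf{w}(t)-\mathbf{w}(0)\quad\text{for } \mathbf{w}\in AC([0,\infty[),$$ $$\mathrm{D}_{\mathbf{F}}\,\mathrm{J}_{\mathbf{F}}\,\mathbf{v}(t)=\mathbf{v}(t)\quad\text{for } \mathbf{v}\in\mathcal{L}^1_{\mathrm{loc}}([0,\infty[).$$
   Context: $N\ge1$ is fixed and $\mathcal{S}$ is the space of real symmetric $N\times N$ matrices. A function $\mathbf{F}:\,]0,\infty[\,\to\mathcal{S}$ is completely monotone (CM) if it is infinitely differentiable and $(-1)^n\frac{\mathrm{d}^n}{\mathrm{d}t^n}\left(\mathbf{v}^{\mathsf T}\mathbf{F}(t)\,\mathbf{v}\right)\ge0$ for all $t>0$, all integers $n\ge0$ and all $\mathbf{v}\in\mathbb{R}^N$. It is locally integrable completely monotone (LICM) if it is CM and integrable over $]0,1]$. An LICM function $\mathbf{F}$ is called singular if $\mathbf{F}_0=0$, where $\mathbf{F}_0:=\lim_{t\to0}\mathbf{F}(t)^{-1}$. The convolution of a matrix-valued function with a matrix-valued or $\mathbb{R}^N$-valued function is $(\mathbf{F}\ast\mathbf{g})(t)=\int_0^t\mathbf{F}(t-s)\,\mathbf{g}(s)\,\mathrm{d}s$.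 $AC([0,\infty[)$ denotes the absolutely continuous functions $[0,\infty[\,\to\mathbb{R}^N$ and $\mathcal{L}^1_{\mathrm{loc}}([0,\infty[)$ the locally integrable $\mathbb{R}^N$-valued functions on $[0,\infty[$. For a singular LICM function $\mathbf{F}$, let $\mathbf{G}$ be the solution of the Sonine equation $\mathbf{F}\ast\mathbf{G}=\mathbf{I}$, where $\mathbf{I}$ is the identity matrix; $\mathbf{G}$ is a singular LICM function. With $\mathrm{D}=\mathrm{d}/\mathrm{d}t$, the $\mathbf{F}$-derivative is defined by $$\mathrm{D}_{\mathbf{F}}\,\mathbf{v}(t)=\mathrm{D}\left[\mathbf{F}(t)\ast\mathbf{v}(t)\right]-\mathbf{F}(t)\,\mathbf{v}(0)\equiv\mathbf{F}\ast\mathrm{D}\mathbf{v}$$ for every absolutely continuous function $\mathbf{v}:[0,\infty[\,\to\mathbb{R}^N$. The $\mathbf{F}$-integral operator is defined by $\mathrm{J}_{\mathbf{F}}\,\mathbf{v}(t):=(\mathbf{G}\ast\mathbf{v})(t)$. *)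

theory Defs
  imports "HOL-Analysis.Analysis"
begin

definition completely_monotone :: "(real \<Rightarrow> real^'n^'n) \<Rightarrow> bool" where
  "completely_monotone F \<longleftrightarrow>
     (\<forall>t>0. transpose (F t) = F t) \<and>
     (\<forall>n i j. \<forall>t>0. (deriv ^^ n) (\<lambda>s. F s $ i $ j) differentiable (at t)) \<and>
     (\<forall>n v. \<forall>t>0. (-1) ^ n * (deriv ^^ n) (\<lambda>s. v \<bullet> (F s *v v)) t \<ge> 0)"

definition LICM :: "(real \<Rightarrow> real^'n^'n) \<Rightarrow> bool" where
  "LICM F \<longleftrightarrow> completely_monotone F \<and> F absolutely_integrable_on {0<..1}"

text \<open>The value of \<^const>\<open>matrix_inv\<close> at a non-invertible matrix is arbitrary, so that the limit
  of the inverses needs the invertibility of \<open>F t\<close> for small \<open>t\<close> as a separate clause.\<close>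

definition singular_LICM :: "(real \<Rightarrow> real^'n^'n) \<Rightarrow> bool" where
  "singular_LICM F \<longleftrightarrow>
     LICM F \<and> (\<forall>\<^sub>F t in at_right 0. invertible (F t)) \<and>
     ((\<lambda>t. matrix_inv (F t)) \<longlongrightarrow> 0) (at_right 0)"

definition conv_mm :: "(real \<Rightarrow> real^'n^'n) \<Rightarrow> (real \<Rightarrow> real^'n^'n) \<Rightarrow> real \<Rightarrow> real^'n^'n" where
  "conv_mm F G t = (LINT s:{0..t}|lebesgue. F (t - s) ** G s)"

definition conv_mv :: "(real \<Rightarrow> real^'n^'n) \<Rightarrow> (real \<Rightarrow> real^'n) \<Rightarrow> real \<Rightarrow> real^'n" where
  "conv_mv F g t = (LINT s:{0..t}|lebesgue. F (t - s) *v g s)"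

definition sonine_solution :: "(real \<Rightarrow> real^'n^'n) \<Rightarrow> (real \<Rightarrow> real^'n^'n) \<Rightarrow> bool" where
  "sonine_solution F G \<longleftrightarrow> singular_LICM G \<and> (\<forall>t>0. conv_mm F G t = mat 1)"

definition locally_integrable :: "(real \<Rightarrow> real^'n) \<Rightarrow> bool" where
  "locally_integrable v \<longleftrightarrow> (\<forall>T>0. v absolutely_integrable_on {0..T})"

text \<open>Absolute continuity on \<open>[0,\<infinity>[\<close> is required on every interval \<open>[0,T]\<close>, so that for instance
  the polynomials are included.\<close>

definition AC :: "(real \<Rightarrow> real^'n) \<Rightarrow> bool" where
  "AC w \<longleftrightarrow>
     (\<forall>T>0. \<forall>\<epsilon>>0. \<exists>\<delta>>0. \<forall>(m::nat) a b.
        (\<forall>k<m. 0 \<le> a k \<and> a k \<le> b k \<and> b k \<le> T) \<and>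
        disjoint_family_on (\<lambda>k. {a k<..<b k}) {..<m} \<and>
        (\<Sum>k<m. b k - a k) < \<delta> \<longrightarrow>
        (\<Sum>k<m. norm (w (b k) - w (a k))) < \<epsilon>)"

text \<open>The convolution of locally integrable functions exists only almost everywhere, and its Lebesgue
  integral may diverge at a dense set of points. The operator \<open>D = d/dt\<close> therefore acts on functions
  up to null sets: it differentiates the absolutely continuous representative, which is unique on
  \<open>[0,\<infinity>[\<close> when it exists.\<close>

definition AC_rep :: "(real \<Rightarrow> real^'n) \<Rightarrow> real \<Rightarrow> real^'n" where
  "AC_rep u = (SOME U. AC U \<and> (AE t in lebesgue_on {0..}. U t = u t))"

definition D_op :: "(real \<Rightarrow> real^'n) \<Rightarrow> real \<Rightarrow> real^'n" where
  "D_op u t = vector_derivative (AC_rep u) (at t)"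

text \<open>The first of the two expressions for the \<open>F\<close>-derivative also makes sense for functions that are
  not absolutely continuous, such as \<open>J_op G v\<close> with \<open>v\<close> locally integrable. The value of
  \<open>J_op G v\<close> at \<open>0\<close> is \<open>0\<close>, an integral over a single point.\<close>

definition D_F :: "(real \<Rightarrow> real^'n^'n) \<Rightarrow> (real \<Rightarrow> real^'n) \<Rightarrow> real \<Rightarrow> real^'n" where
  "D_F F v t = D_op (conv_mv F v) t - F t *v v 0"

text \<open>The \<open>F\<close>-integral is given by the Sonine solution \<open>G\<close> associated with \<open>F\<close>.\<close>

definition J_op :: "(real \<Rightarrow> real^'n^'n) \<Rightarrow> (real \<Rightarrow> real^'n) \<Rightarrow> real \<Rightarrow> real^'n" where
  "J_op G v = conv_mv G v"

end

theory Submission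
  imports Defs
begin

text \<open>An absolutely continuous \<open>w\<close> is an indefinite integral: its slopes along dyadic partitions form a
  Cauchy sequence in \<open>L\<^sup>1\<close>. Indeed the length of the inscribed polygons increases to a finite limit,
  strict convexity of the arc length integrand \<open>s \<mapsto> sqrt (1 + |s|\<^sup>2)\<close> turns small increments of
  length into small differences of slopes as long as the slopes are bounded, and absolute continuity
  makes the contribution of large slopes uniformly small.

  Fubini's theorem makes convolution associative almost everywhere. With \<open>w = w 0 + 1 * f\<close> this gives
  \<open>F * w = 1 * (F w 0 + F * f)\<close>, so Lebesgue's differentiation theorem yields \<open>D_F w = F * f\<close>, and
  \<open>G * (F * f) = (G * F) * f = 1 * f = w - w 0\<close>. Here \<open>G * F = I\<close> follows from \<open>F * G = I\<close> by
  transposition because the values of \<open>F\<close> and \<open>G\<close> are symmetric. Likewise \<open>F * (G * v) = 1 * v\<close>,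
  whose derivative is \<open>v\<close> almost everywhere.\<close>

section \<open>Absolutely continuous functions are indefinite integrals\<close>

text \<open>Differentiability of \<open>w\<close> almost everywhere is a result here and not a
  starting point: the density comes from completeness of L^1 on each bounded interval, and only
  afterwards is it recognised as the derivative of \<open>w\<close>, which makes it independent of
  the interval. A second difficulty is that values at 0 are arbitrary, since \<open>F\<close>,
  \<open>G\<close> and the Sonine equation are constrained for positive arguments only, and that
  convolutions may diverge on a null set. Intermediate identities are therefore stated for almost
  every positive t. They remain usable for two reasons. Changing the right factor on a null set
  leaves a convolution unchanged at every t, so they may be substituted under a further convolution.
  And a continuous function on [0,\<infinity>[ is determined by its values almost everywhere, so
  \<open>AC_rep\<close> is determined there as soon as one absolutely continuous representative is
  known.\<close>

lemma L1_Cauchy_imp_L1_convergent: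
  fixes s :: "nat \<Rightarrow> 'a \<Rightarrow> 'b::{banach, second_countable_topology}"
  assumes s[measurable]: "\<And>n. integrable M (s n)"
    and cauchy: "\<And>e. e > 0 \<Longrightarrow> \<exists>N. \<forall>i\<ge>N. \<forall>j\<ge>N. (LINT x|M. norm (s i x - s j x)) < e"
  obtains f where "integrable M f" "(\<lambda>n. LINT x|M. norm (s n x - f x)) \<longlonglongrightarrow> 0"
proof -
  obtain r where r: "strict_mono r" and ae: "AE x in M. Cauchy (\<lambda>i. s (r i) x)"
    using cauchy_L1_AE_cauchy_subseq[OF s cauchy] by blast
  have sm[measurable]: "s n \<in> borel_measurable M" for n
    using s by (rule borel_measurable_integrable)
  define f where "f = (\<lambda>x. lim (\<lambda>i. s (r i) x))"
  have f[measurable]: "f \<in> borel_measurable M"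
    unfolding f_def by (intro borel_measurable_lim_metric) auto
  have lim: "AE x in M. (\<lambda>i. s (r i) x) \<longlonglongrightarrow> f x"
    using ae
  proof eventually_elim
    case (elim x)
    then show ?case
      unfolding f_def by (simp add: Cauchy_convergent_iff convergent_LIMSEQ_iff)
  qed
  \<comment> \<open>Fatou's lemma along the subsequence in the second index turns the Cauchy bound
    into a bound on the distance to the limit.\<close>
  have bound: "\<exists>N. \<forall>n\<ge>N. (\<integral>\<^sup>+x. norm (s n x - f x) \<partial>M) \<le> ennreal e" if "e > 0" for e
  proof -
    obtain N where N: "\<And>i j. i \<ge> N \<Longrightarrow> j \<ge> N \<Longrightarrow> (LINT x|M. norm (s i x - s j x)) < e"
      using cauchy[OF \<open>e > 0\<close>] by blast
    have "(\<integral>\<^sup>+x. norm (s n x - f x) \<partial>M) \<le> ennreal e" if "n \<ge> N" for n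
    proof -
      have "(\<integral>\<^sup>+x. norm (s n x - f x) \<partial>M)
          = (\<integral>\<^sup>+x. liminf (\<lambda>i. ennreal (norm (s n x - s (r i) x))) \<partial>M)"
        using lim
      proof (intro nn_integral_cong_AE, eventually_elim)
        case (elim x)
        have "(\<lambda>i. ennreal (norm (s n x - s (r i) x))) \<longlonglongrightarrow> ennreal (norm (s n x - f x))"
          by (intro tendsto_intros elim)
        then show ?case
          by (rule lim_imp_Liminf[OF sequentially_bot, symmetric])
      qed
      also have "\<dots> \<le> liminf (\<lambda>i. \<integral>\<^sup>+x. ennreal (norm (s n x - s (r i) x)) \<partial>M)"
        by (intro nn_integral_liminf) auto
      also have "\<dots> \<le> liminf (\<lambda>i. ennreal e)"
      proof (intro Liminf_mono eventually_sequentiallyI)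
        fix i assume "i \<ge> N"
        then have "r i \<ge> N"
          using seq_suble[OF r, of i] by linarith
        have "(\<integral>\<^sup>+x. ennreal (norm (s n x - s (r i) x)) \<partial>M) = ennreal (LINT x|M. norm (s n x - s (r i) x))"
          by (intro nn_integral_eq_integral integrable_norm Bochner_Integration.integrable_diff s) auto
        also have "\<dots> \<le> ennreal e"
          using N[OF \<open>n \<ge> N\<close> \<open>r i \<ge> N\<close>] by (intro ennreal_leI) simp
        finally show "(\<integral>\<^sup>+x. ennreal (norm (s n x - s (r i) x)) \<partial>M) \<le> ennreal e" .
      qed
      finally show ?thesis
        by (simp add: Liminf_const)
    qed
    then show ?thesis by blast
  qed
  have int: "integrable M f"
  proof -
    obtain N where "(\<integral>\<^sup>+x. norm (s N x - f x) \<partial>M) \<le> ennreal 1"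
      using bound[of 1] by auto
    then have "integrable M (\<lambda>x. s N x - f x)"
      by (intro integrableI_bounded) (auto intro: le_less_trans)
    from Bochner_Integration.integrable_diff[OF s[of N] this] show ?thesis
      by simp
  qed
  moreover have "(\<lambda>n. LINT x|M. norm (s n x - f x)) \<longlonglongrightarrow> 0"
  proof (rule LIMSEQ_I)
    fix e :: real assume "0 < e"
    then obtain N where N: "\<And>n. n \<ge> N \<Longrightarrow> (\<integral>\<^sup>+x. norm (s n x - f x) \<partial>M) \<le> ennreal (e/2)"
      using bound[of "e/2"] by auto
    have "(LINT x|M. norm (s n x - f x)) \<le> e/2" if "n \<ge> N" for n
    proof -
      have "ennreal (LINT x|M. norm (s n x - f x)) = (\<integral>\<^sup>+x. norm (s n x - f x) \<partial>M)"
        by (intro nn_integral_eq_integral[symmetric] integrable_norm Bochner_Integration.integrable_diff s int) auto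
      then show ?thesis
        using N[OF that] \<open>0 < e\<close> by (metis ennreal_le_iff half_gt_zero less_imp_le)
    qed
    moreover have "0 \<le> (LINT x|M. norm (s n x - f x))" for n
      by simp
    ultimately have "norm ((LINT x|M. norm (s n x - f x)) - 0) < e" if "n \<ge> N" for n
      using that \<open>0 < e\<close> by (simp only: diff_0_right real_norm_def abs_of_nonneg) force
    then show "\<exists>no. \<forall>n\<ge>no. norm ((LINT x|M. norm (s n x - f x)) - 0) < e"
      by blast
  qed
  ultimately show ?thesis
    using that by blast
qed

section \<open>Strict convexity of the arc length integrand\<close>

text \<open>\<open>arclen s\<close> is the arc length per unit of parameter of a graph of slope \<open>s\<close>, and \<open>arclen_gap\<close>
  is its Bregman divergence: the inequality below is a quantitative form of strict convexity.\<close>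

definition arclen :: "'a::real_inner \<Rightarrow> real" where
  "arclen x = sqrt (1 + (norm x)\<^sup>2)"

lemma arclen_ge_1: "arclen x \<ge> 1"
  by (simp add: arclen_def)

lemma arclen_pos: "arclen x > 0"
  using arclen_ge_1[of x] by linarith

lemma arclen_sq: "(arclen x)\<^sup>2 = 1 + (norm x)\<^sup>2"
  by (simp add: arclen_def)

lemma arclen_le: "arclen x \<le> 1 + norm x"
  unfolding arclen_def by (rule real_le_lsqrt) (auto simp: power2_eq_square algebra_simps)

definition arclen_gap :: "'a::real_inner \<Rightarrow> 'a \<Rightarrow> real" where
  "arclen_gap x y = arclen y - arclen x - (x \<bullet> (y - x)) / arclen x"

text \<open>Let p and q be the inner product and the product of the norms of the vectors (1,x) and
  (1,y). Cauchy-Schwarz for x and y gives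
  \<open>q\<^sup>2 - p\<^sup>2 \<ge> (norm (y - x))\<^sup>2\<close>, while
  \<open>arclen x * arclen_gap x y\<close> is exactly q - p, and q + p is at most 2q.\<close>

lemma norm_diff_sq_le_arclen_gap:
  "(norm (y - x))\<^sup>2 \<le> 2 * (arclen x)\<^sup>2 * arclen y * arclen_gap x y"
proof -
  define p q where "p = 1 + x \<bullet> y" and "q = arclen x * arclen y"
  have q: "q > 0"
    by (simp add: q_def arclen_pos)
  have "(x \<bullet> y)\<^sup>2 \<le> (norm x)\<^sup>2 * (norm y)\<^sup>2"
    using Cauchy_Schwarz_ineq[of x y] by (simp add: power2_norm_eq_inner)
  moreover have "q\<^sup>2 = (1 + (norm x)\<^sup>2) * (1 + (norm y)\<^sup>2)"
    by (simp add: q_def power_mult_distrib arclen_sq)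
  moreover have "(norm (y - x))\<^sup>2 = (norm x)\<^sup>2 + (norm y)\<^sup>2 - 2 * (x \<bullet> y)"
    by (simp add: power2_norm_eq_inner inner_diff_left inner_diff_right inner_commute)
  ultimately have qp: "(norm (y - x))\<^sup>2 \<le> q\<^sup>2 - p\<^sup>2"
    unfolding p_def by (simp add: power2_eq_square algebra_simps)
  then have "p\<^sup>2 \<le> q\<^sup>2"
    using zero_le_power2[of "norm (y - x)"] by linarith
  then have "p \<le> q"
    using q by (rule power2_le_imp_le[OF _ less_imp_le])
  have "q\<^sup>2 - p\<^sup>2 = (q - p) * (q + p)"
    by (simp add: power2_eq_square algebra_simps)
  also have "\<dots> \<le> (q - p) * (2 * q)"
    using \<open>p \<le> q\<close> by (intro mult_left_mono) auto
  also have "\<dots> = 2 * (arclen x)\<^sup>2 * arclen y * arclen_gap x y"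
  proof -
    have "arclen x * arclen_gap x y = arclen x * arclen y - (arclen x)\<^sup>2 - x \<bullet> (y - x)"
      using arclen_pos[of x] by (simp add: arclen_gap_def field_simps power2_eq_square)
    also have "\<dots> = q - p"
      by (simp add: arclen_sq p_def q_def inner_diff_right power2_norm_eq_inner)
    finally have "arclen x * arclen_gap x y = q - p" .
    moreover have "2 * (arclen x)\<^sup>2 * arclen y * arclen_gap x y = 2 * q * (arclen x * arclen_gap x y)"
      by (simp add: q_def power2_eq_square)
    ultimately show ?thesis
      by simp
  qed
  finally show ?thesis
    using qp by linarith
qed

lemma arclen_gap_nonneg: "0 \<le> arclen_gap x y"
proof -
  have "0 \<le> (2 * (arclen x)\<^sup>2 * arclen y) * arclen_gap x y"
    by (rule order_trans[OF zero_le_power2 norm_diff_sq_le_arclen_gap])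
  moreover have "0 < 2 * (arclen x)\<^sup>2 * arclen y"
    using arclen_pos[of x] arclen_pos[of y] by simp
  ultimately show ?thesis
    by (simp only: zero_le_mult_iff) linarith
qed

text \<open>If some slope exceeds \<open>K\<close>, twice the large slopes dominate the sum of both
  norms; this is the origin of the factors 2. Otherwise both arc lengths are at most
  \<open>1 + K\<close>, and a distance d satisfies
  \<open>d \<le> \<eta> + d\<^sup>2 / \<eta>\<close>, so that the quadratic bound applies.\<close>

lemma norm_diff_le_arclen_gap:
  fixes x y :: "'a::real_inner"
  assumes "\<eta> > 0" "K \<ge> 0"
  shows "norm (y - x) \<le> \<eta> + (2 * (1 + K)^3 / \<eta>) * arclen_gap x y
     + 2 * (if norm x > K then norm x else 0) + 2 * (if norm y > K then norm y else 0)"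
proof (cases "norm x > K \<or> norm y > K")
  case True
  have "norm (y - x) \<le> norm x + norm y"
    using norm_triangle_ineq4[of y x] by linarith
  moreover have "0 \<le> (2 * (1 + K)^3 / \<eta>) * arclen_gap x y"
    using assms arclen_gap_nonneg[of x y] by simp
  moreover have bad: "norm x + norm y \<le> 2 * (if norm x > K then norm x else 0) + 2 * (if norm y > K then norm y else 0)"
    using True norm_ge_zero[of x] norm_ge_zero[of y] by (cases "norm x > K"; cases "norm y > K") simp_all
  ultimately show ?thesis
    using bad assms(1) by linarith
next
  case False
  then have le: "norm x \<le> K" "norm y \<le> K" by auto
  have ax: "arclen x \<le> 1 + K" and ay: "arclen y \<le> 1 + K"
    using le arclen_le[of x] arclen_le[of y] by linarith+
  have "(arclen x)\<^sup>2 * arclen y \<le> (1 + K)\<^sup>2 * (1 + K)"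
    using ax ay arclen_pos[of x] arclen_pos[of y] assms by (intro mult_mono power_mono) auto
  then have "2 * (arclen x)\<^sup>2 * arclen y \<le> 2 * (1 + K)^3"
    by (simp add: power2_eq_square power3_eq_cube)
  then have "2 * (arclen x)\<^sup>2 * arclen y * arclen_gap x y \<le> 2 * (1 + K)^3 * arclen_gap x y"
    using arclen_gap_nonneg[of x y] by (rule mult_right_mono)
  then have sq: "(norm (y - x))\<^sup>2 \<le> 2 * (1 + K)^3 * arclen_gap x y"
    using norm_diff_sq_le_arclen_gap[of y x] by linarith
  have "norm (y - x) \<le> \<eta> + (norm (y - x))\<^sup>2 / \<eta>"
  proof (cases "norm (y - x) \<le> \<eta>")
    case True
    then show ?thesis using assms(1) by (simp add: add_increasing2)
  next
    case False
    then have "\<eta> * norm (y - x) \<le> (norm (y - x))\<^sup>2"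
      by (simp add: power2_eq_square mult_right_mono)
    then have "norm (y - x) \<le> (norm (y - x))\<^sup>2 / \<eta>"
      using assms(1) by (simp add: pos_le_divide_eq mult.commute)
    then show ?thesis
      using assms(1) by linarith
  qed
  also have "(norm (y - x))\<^sup>2 / \<eta> \<le> (2 * (1 + K)^3 / \<eta>) * arclen_gap x y"
    using sq assms(1) by (simp add: divide_right_mono)
  finally show ?thesis
    using False by auto
qed

section \<open>Slopes along dyadic partitions\<close>

lemma has_integral_step:
  fixes \<phi> :: "nat \<Rightarrow> 'a::euclidean_space"
  assumes "d > 0"
  shows "((\<lambda>t. \<phi> (nat \<lfloor>t / d\<rfloor>)) has_integral d *\<^sub>R (\<Sum>k<K. \<phi> k)) {0..d * real K}"
proof (induction K)
  case 0
  then show ?case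
    using has_integral_refl(2)[of "\<lambda>t. \<phi> (nat \<lfloor>t / d\<rfloor>)" 0] by simp
next
  case (Suc K)
  have "((\<lambda>t. \<phi> K) has_integral d *\<^sub>R \<phi> K) {d * real K..d * real (Suc K)}"
    using has_integral_const_real[of "\<phi> K" "d * real K" "d * real (Suc K)"] assms
    by (simp add: algebra_simps)
  \<comment> \<open>At the right end point the floor has already jumped to the next cell, so the two
    functions are compared in the interior only.\<close>
  then have "((\<lambda>t. \<phi> (nat \<lfloor>t / d\<rfloor>)) has_integral d *\<^sub>R \<phi> K) {d * real K..d * real (Suc K)}"
  proof (rule has_integral_spike_interior[where a = "d * real K" and b = "d * real (Suc K)", unfolded interval_cbox[symmetric]])
    fix t assume "t \<in> box (d * real K) (d * real (Suc K))"
    then have "real K \<le> t / d" "t / d < real K + 1"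
      using assms by (auto simp: box_real field_simps)
    then have "\<lfloor>t / d\<rfloor> = int K"
      by (intro floor_unique) auto
    then show "\<phi> (nat \<lfloor>t / d\<rfloor>) = \<phi> K" by simp
  qed
  from has_integral_combine[OF _ _ Suc.IH this] assms
  show ?case by (simp add: algebra_simps)
qed

text \<open>The arguments of \<open>G\<close> are the fine index and the index of the coarse cell
  containing it. One regrouping thus serves summands that depend on either index alone or, as the
  divergence does, on both.\<close>

lemma sum_dyadic_blocks:
  fixes G :: "nat \<Rightarrow> nat \<Rightarrow> 'a::comm_monoid_add"
  shows "(\<Sum>k<2^(n+r). G k (k div 2^r)) = (\<Sum>j<2^n. \<Sum>k=j*2^r..<j*2^r+2^r. G k j)"
proof -
  have "(\<Sum>j<2^n. \<Sum>k=j*2^r..<j*2^r+2^r. G k j) = (\<Sum>j<2^n. \<Sum>k=j*2^r..<j*2^r+2^r. G k (k div 2^r))"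
  proof (intro sum.cong refl)
    fix j k :: nat assume "k \<in> {j*2^r..<j*2^r+2^r}"
    then have "k div 2^r = j"
      by (intro div_nat_eqI) (auto simp: algebra_simps)
    then show "G k j = G k (k div 2^r)" by simp
  qed
  then show ?thesis
    by (simp add: sum.nat_group power_add)
qed

definition dslope :: "(real \<Rightarrow> 'a::real_normed_vector) \<Rightarrow> real \<Rightarrow> nat \<Rightarrow> nat \<Rightarrow> 'a" where
  "dslope w T n k = (2^n / T) *\<^sub>R (w (T * real (Suc k) / 2^n) - w (T * real k / 2^n))"

text \<open>Telescoping. As functions of t the slopes thus form a dyadic martingale.\<close>

lemma sum_dslope_block:
  "(\<Sum>k=j*2^r..<j*2^r+2^r. dslope w T (n + r) k) = 2^r *\<^sub>R dslope w T n j"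
proof -
  have "(\<Sum>k=j*2^r..<j*2^r+2^r. dslope w T (n + r) k)
      = (2^(n+r) / T) *\<^sub>R (w (T * real (j*2^r+2^r) / 2^(n+r)) - w (T * real (j*2^r) / 2^(n+r)))"
    unfolding dslope_def scaleR_sum_right[symmetric]
    by (subst sum_Suc_diff') auto
  moreover have "T * real (j*2^r+2^r) / 2^(n+r) = T * real (Suc j) / 2^n"
    "T * real (j*2^r) / 2^(n+r) = T * real j / 2^n"
    by (simp_all add: power_add field_simps)
  ultimately show ?thesis
    by (simp add: dslope_def power_add mult.commute)
qed

text \<open>This is uniform integrability of the slopes over all levels at once:
  \<open>\<delta>\<close> is chosen before \<open>n\<close> and \<open>A\<close>.\<close>

lemma AC_dslope:
  assumes "AC w" "T > 0" "e > 0"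
  obtains \<delta> where "\<delta> > 0"
    "\<And>n A. A \<subseteq> {..<2^n} \<Longrightarrow> T / 2^n * card A < \<delta> \<Longrightarrow> T / 2^n * (\<Sum>k\<in>A. norm (dslope w T n k)) < e"
proof -
  obtain \<delta> where "\<delta> > 0" and ac: "\<forall>(m::nat) a b.
        (\<forall>k<m. 0 \<le> a k \<and> a k \<le> b k \<and> b k \<le> T) \<and>
        disjoint_family_on (\<lambda>k. {a k<..<b k}) {..<m} \<and>
        (\<Sum>k<m. b k - a k) < \<delta> \<longrightarrow>
        (\<Sum>k<m. norm (w (b k) - w (a k))) < e"
    using assms(1)[unfolded AC_def, rule_format, OF assms(2,3)] by auto
  have \<delta>: "(\<Sum>k<m. norm (w (b k) - w (a k))) < e"
    if "\<forall>k<m. 0 \<le> a k \<and> a k \<le> b k \<and> b k \<le> T"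
      "disjoint_family_on (\<lambda>k. {a k<..<b k}) {..<m}"
      "(\<Sum>k<m. b k - a k) < \<delta>" for m :: nat and a b
    using ac that by blast
  show ?thesis
  proof
    show "\<delta> > 0" by fact
    fix n A assume A: "A \<subseteq> {..<2^n::nat}" and card: "T / 2^n * card A < \<delta>"
    define p where "p k = T * real k / 2^n" for k
    \<comment> \<open>A cell outside \<open>A\<close> becomes an interval of length 0, so the family
      keeps the index set \<open>{..<2^n}\<close> without an enumeration of
      \<open>A\<close>.\<close>
    define b where "b k = (if k \<in> A then p (Suc k) else p k)" for k
    have p_mono: "p i \<le> p j" if "i \<le> j" for i j
      using that \<open>T > 0\<close> by (auto simp: p_def divide_right_mono)
    have pb: "p k \<le> b k" "b k \<le> p (Suc k)" for k
      using p_mono[of k "Suc k"] by (auto simp: b_def)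
    have fin: "finite A"
      using A finite_subset by blast
    have sum_A: "(\<Sum>k<2^n. if k \<in> A then g k else 0) = sum g A" for g :: "nat \<Rightarrow> real"
      using A by (simp add: sum.inter_restrict[symmetric] Int_absorb1)
    have "(\<Sum>k<2^n. norm (w (b k) - w (p k))) < e"
    proof (rule \<delta>)
      show "\<forall>k<2^n. 0 \<le> p k \<and> p k \<le> b k \<and> b k \<le> T"
      proof (intro allI impI conjI pb)
        fix k :: nat assume "k < 2^n"
        show "0 \<le> p k"
          using \<open>T > 0\<close> by (simp add: p_def)
        have "b k \<le> p (2^n)"
          using pb(2)[of k] p_mono[of "Suc k" "2^n"] \<open>k < 2^n\<close> by simp
        then show "b k \<le> T"
          by (simp add: p_def)
      qed
      show "disjoint_family_on (\<lambda>k. {p k<..<b k}) {..<2^n}"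
        unfolding disjoint_family_on_def
      proof (intro ballI impI)
        fix i j :: nat assume "i \<noteq> j"
        then consider "Suc i \<le> j" | "Suc j \<le> i" by linarith
        then show "{p i<..<b i} \<inter> {p j<..<b j} = {}"
        proof cases
          case 1
          with p_mono pb(2)[of i] have "b i \<le> p j" by (meson order_trans)
          then show ?thesis by auto
        next
          case 2
          with p_mono pb(2)[of j] have "b j \<le> p i" by (meson order_trans)
          then show ?thesis by auto
        qed
      qed
      have "(\<Sum>k<2^n. b k - p k) = (\<Sum>k<2^n. if k \<in> A then T / 2^n else 0)"
        by (intro sum.cong) (auto simp: b_def p_def field_simps)
      also have "\<dots> = T / 2^n * card A"
        by (simp only: sum_A) simp
      finally show "(\<Sum>k<2^n. b k - p k) < \<delta>"
        using card by simp
    qed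
    also have "(\<Sum>k<2^n. norm (w (b k) - w (p k)))
        = (\<Sum>k<2^n. if k \<in> A then T / 2^n * norm (dslope w T n k) else 0)"
      using \<open>T > 0\<close> by (intro sum.cong) (auto simp: b_def p_def dslope_def)
    also have "\<dots> = T / 2^n * (\<Sum>k\<in>A. norm (dslope w T n k))"
      by (simp only: sum_A sum_distrib_left)
    finally show "T / 2^n * (\<Sum>k\<in>A. norm (dslope w T n k)) < e" .
  qed
qed

text \<open>Bounded variation: once the cells of level \<open>N\<close> are shorter than
  \<open>\<delta>\<close>, the slopes of any finer level contribute at most 1 on each of these
  cells, whence the bound \<open>2^N\<close>.\<close>

lemma AC_dslope_bounded:
  assumes "AC w" "T > 0"
  obtains V N where "\<And>n. n \<ge> N \<Longrightarrow> T / 2^n * (\<Sum>k<2^n. norm (dslope w T n k)) \<le> V"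
proof -
  obtain \<delta> where "\<delta> > 0" and \<delta>: "\<And>n A. A \<subseteq> {..<2^n} \<Longrightarrow> T / 2^n * card A < \<delta>
      \<Longrightarrow> T / 2^n * (\<Sum>k\<in>A. norm (dslope w T n k)) < 1"
    using AC_dslope[OF assms, of 1] by auto
  obtain N where "(1/2)^N < \<delta> / T"
    using real_arch_pow_inv[of "\<delta> / T" "1/2"] \<open>\<delta> > 0\<close> \<open>T > 0\<close> by auto
  then have N: "T / 2^N < \<delta>"
    using \<open>T > 0\<close> by (simp add: field_simps power_divide)
  show ?thesis
  proof (rule that[of N "2^N"])
    fix n assume "n \<ge> N"
    then obtain r where n: "n = N + r"
      using le_Suc_ex by blast
    have "T / 2^n * (\<Sum>k<2^n. norm (dslope w T n k))
        = (\<Sum>j<2^N. T / 2^n * (\<Sum>k=j*2^r..<j*2^r+2^r. norm (dslope w T n k)))"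
      unfolding n sum_dyadic_blocks[where G = "\<lambda>k _. norm (dslope w T (N + r) k)"] sum_distrib_left ..
    also have "\<dots> \<le> (\<Sum>j<2^N::nat. 1)"
    proof (rule sum_mono)
      fix j :: nat assume "j \<in> {..<2^N}"
      let ?B = "{j*2^r..<j*2^r+2^r}"
      have "Suc j \<le> 2^N"
        using \<open>j \<in> {..<2^N}\<close> by auto
      then have "?B \<subseteq> {..<2^n}"
        using mult_le_mono1[of "Suc j" "2^N" "2^r"] by (auto simp: n power_add)
      moreover have "T / 2^n * card ?B < \<delta>"
        using N by (simp add: n power_add)
      ultimately show "T / 2^n * (\<Sum>k\<in>?B. norm (dslope w T n k)) \<le> 1"
        using \<delta>[of ?B n] by simp
    qed
    finally show "T / 2^n * (\<Sum>k<2^n. norm (dslope w T n k)) \<le> 2^N" by simp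
  qed
qed

text \<open>The linear term of \<open>arclen_gap\<close> cancels on each coarse dyadic interval, since a coarse slope is
  the mean of the finer slopes on it.\<close>

lemma sum_arclen_gap_dslope:
  fixes w :: "real \<Rightarrow> 'a::real_inner" and T :: real
  defines "L \<equiv> \<lambda>n. T / 2^n * (\<Sum>k<2^n. arclen (dslope w T n k))"
  shows "T / 2^(n+r) * (\<Sum>k<2^(n+r). arclen_gap (dslope w T n (k div 2^r)) (dslope w T (n+r) k))
      = L (n + r) - L n"
proof -
  let ?x = "dslope w T n" and ?y = "dslope w T (n+r)"
  have "(\<Sum>k<2^(n+r). arclen_gap (?x (k div 2^r)) (?y k))
      = (\<Sum>j<2^n. \<Sum>k=j*2^r..<j*2^r+2^r. arclen_gap (?x j) (?y k))"
    by (rule sum_dyadic_blocks)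
  also have "\<dots> = (\<Sum>j<2^n. (\<Sum>k=j*2^r..<j*2^r+2^r. arclen (?y k)) - 2^r * arclen (?x j))"
  proof (intro sum.cong refl)
    fix j
    have "(\<Sum>k=j*2^r..<j*2^r+2^r. arclen_gap (?x j) (?y k))
        = (\<Sum>k=j*2^r..<j*2^r+2^r. arclen (?y k)) - 2^r * arclen (?x j)
          - (?x j \<bullet> (\<Sum>k=j*2^r..<j*2^r+2^r. ?y k - ?x j)) / arclen (?x j)"
      by (simp add: arclen_gap_def sum_subtractf sum_divide_distrib[symmetric] inner_sum_right inner_diff_right
          del: sum_constant_scaleR)
    also have "(\<Sum>k=j*2^r..<j*2^r+2^r. ?y k - ?x j) = 0"
      by (simp add: sum_subtractf sum_dslope_block sum_constant_scaleR)
    finally show "(\<Sum>k=j*2^r..<j*2^r+2^r. arclen_gap (?x j) (?y k))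
        = (\<Sum>k=j*2^r..<j*2^r+2^r. arclen (?y k)) - 2^r * arclen (?x j)" by simp
  qed
  also have "\<dots> = (\<Sum>k<2^(n+r). arclen (?y k)) - 2^r * (\<Sum>j<2^n. arclen (?x j))"
    by (simp add: sum_subtractf sum_distrib_left sum_dyadic_blocks[where G = "\<lambda>k _. arclen (?y k)"])
  finally show ?thesis
    by (simp add: L_def right_diff_distrib power_add)
qed

text \<open>Small divergence controls the difference of slopes of size at most \<open>K\<close>; larger slopes occur on a
  union of dyadic intervals of small total length, where absolute continuity applies.\<close>

lemma dslope_L1_Cauchy:
  assumes "AC w" "T > 0" "e > 0"
  shows "\<exists>N. \<forall>n\<ge>N. \<forall>r. T / 2^(n+r) * (\<Sum>k<2^(n+r). norm (dslope w T (n+r) k - dslope w T n (k div 2^r))) < e"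
proof -
  let ?x = "dslope w T"
  define L where "L n = T / 2^n * (\<Sum>k<2^n. arclen (dslope w T n k))" for n
  define tail where "tail K n = T / 2^n * (\<Sum>k<2^n. if norm (?x n k) > K then norm (?x n k) else 0)" for K n
  obtain V N0 where V: "\<And>n. n \<ge> N0 \<Longrightarrow> T / 2^n * (\<Sum>k<2^n. norm (?x n k)) \<le> V"
    using AC_dslope_bounded[OF assms(1,2)] by blast
  have "0 \<le> V"
    using \<open>T > 0\<close> by (intro order_trans[OF _ V[of N0]] mult_nonneg_nonneg sum_nonneg) auto
  obtain \<delta> where "\<delta> > 0" and \<delta>: "\<And>n A. A \<subseteq> {..<2^n} \<Longrightarrow> T / 2^n * card A < \<delta>
      \<Longrightarrow> T / 2^n * (\<Sum>k\<in>A. norm (dslope w T n k)) < e / 8"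
    using AC_dslope[OF assms(1,2), of "e/8"] \<open>e > 0\<close> by auto
  \<comment> \<open>By Markov's inequality the cells with slope above \<open>K\<close> have total
    length at most \<open>V / K\<close>, which this choice makes smaller than
    \<open>\<delta>\<close>. The summand 1 gives strictness and \<open>K > 0\<close>.\<close>
  define K where "K = (V + 1) / \<delta>"
  have "K > 0"
    using \<open>0 \<le> V\<close> \<open>\<delta> > 0\<close> by (simp add: K_def)
  have tail: "tail K n < e / 8" if "n \<ge> N0" for n
  proof -
    define A where "A = {k. k < 2^n \<and> norm (?x n k) > K}"
    have A: "A \<subseteq> {..<2^n}" by (auto simp: A_def)
    have "K * (T / 2^n * card A) = T / 2^n * (\<Sum>k\<in>A. K)" by simp
    also have "\<dots> \<le> T / 2^n * (\<Sum>k\<in>A. norm (?x n k))"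
      using \<open>T > 0\<close> by (intro mult_left_mono sum_mono) (auto simp: A_def)
    also have "\<dots> \<le> T / 2^n * (\<Sum>k<2^n. norm (?x n k))"
      using \<open>T > 0\<close> A by (intro mult_left_mono sum_mono2) auto
    also have "\<dots> < K * \<delta>"
      using V[OF that] \<open>\<delta> > 0\<close> by (simp add: K_def)
    finally have "T / 2^n * card A < \<delta>"
      using \<open>K > 0\<close> by (simp only: mult_less_cancel_left_pos)
    then have "T / 2^n * (\<Sum>k\<in>A. norm (?x n k)) < e / 8"
      by (rule \<delta>[OF A])
    also have "(\<Sum>k\<in>A. norm (?x n k)) = (\<Sum>k<2^n. if norm (?x n k) > K then norm (?x n k) else 0)"
      unfolding A_def by (subst sum.inter_filter[symmetric]) (auto simp: conj_commute lessThan_def)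
    finally show ?thesis by (simp add: tail_def)
  qed
  have gap: "T / 2^(n+r) * (\<Sum>k<2^(n+r). arclen_gap (?x n (k div 2^r)) (?x (n+r) k)) = L (n + r) - L n" for n r
    unfolding L_def by (rule sum_arclen_gap_dslope)
  have "incseq L"
  proof (rule incseq_SucI)
    fix n
    have "0 \<le> T / 2^(n+1) * (\<Sum>k<2^(n+1). arclen_gap (?x n (k div 2^1)) (?x (n+1) k))"
      using \<open>T > 0\<close> by (intro mult_nonneg_nonneg sum_nonneg arclen_gap_nonneg) auto
    then show "L n \<le> L (Suc n)"
      using gap[of n 1] by simp
  qed
  \<comment> \<open>The variation bound holds from level \<open>N0\<close> on; monotonicity of
    \<open>L\<close> carries it to the lower levels.\<close>
  moreover have "L n \<le> T + V" for n
  proof -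
    have "L n \<le> L (max n N0)"
      using \<open>incseq L\<close> by (rule incseqD) simp
    also have "\<dots> \<le> T / 2^(max n N0) * (\<Sum>k<2^(max n N0). 1 + norm (?x (max n N0) k))"
      unfolding L_def using \<open>T > 0\<close> by (intro mult_left_mono sum_mono arclen_le) auto
    also have "\<dots> = T + T / 2^(max n N0) * (\<Sum>k<2^(max n N0). norm (?x (max n N0) k))"
      by (simp add: sum.distrib distrib_left)
    also have "\<dots> \<le> T + V"
      using V[of "max n N0"] by simp
    finally show ?thesis .
  qed
  ultimately have "Cauchy L"
    by (metis LIMSEQ_imp_Cauchy incseq_convergent)
  \<comment> \<open>The error budget: \<open>e / 8\<close> for \<open>T * \<eta>\<close>,
    \<open>e / 8\<close> for the divergence and \<open>2 * (e / 8)\<close> for each of the two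
    tails, together three quarters of \<open>e\<close>.\<close>
  define \<eta> where "\<eta> = e / (8 * T)"
  have "\<eta> > 0" using assms by (simp add: \<eta>_def)
  define C where "C = 2 * (1 + K)^3 / \<eta>"
  have "C > 0" using \<open>K > 0\<close> \<open>\<eta> > 0\<close> by (simp add: C_def)
  obtain N1 where N1: "\<And>m n. m \<ge> N1 \<Longrightarrow> n \<ge> N1 \<Longrightarrow> norm (L m - L n) < e / (8 * C)"
    using CauchyD[OF \<open>Cauchy L\<close>, of "e / (8 * C)"] \<open>C > 0\<close> \<open>e > 0\<close> by auto
  have "T / 2^(n+r) * (\<Sum>k<2^(n+r). norm (?x (n+r) k - ?x n (k div 2^r))) < e"
    if n: "n \<ge> max N0 N1" for n r
  proof -
    let ?t = "\<lambda>n k. if norm (?x n k) > K then norm (?x n k) else 0"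
    let ?D = "T / 2^(n+r)"
    have "(\<Sum>k<2^(n+r). norm (?x (n+r) k - ?x n (k div 2^r)))
        \<le> (\<Sum>k<2^(n+r). \<eta> + C * arclen_gap (?x n (k div 2^r)) (?x (n+r) k)
              + 2 * ?t n (k div 2^r) + 2 * ?t (n + r) k)"
      unfolding C_def using \<open>\<eta> > 0\<close> \<open>K > 0\<close> by (intro sum_mono norm_diff_le_arclen_gap) auto
    also have "\<dots> = 2^(n+r) * \<eta> + C * (\<Sum>k<2^(n+r). arclen_gap (?x n (k div 2^r)) (?x (n+r) k))
        + 2 * (\<Sum>k<2^(n+r). ?t n (k div 2^r)) + 2 * (\<Sum>k<2^(n+r). ?t (n + r) k)"
      by (simp only: sum.distrib sum_distrib_left) simp
    also have "(\<Sum>k<2^(n+r). ?t n (k div 2^r)) = 2^r * (\<Sum>k<2^n. ?t n k)"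
      by (simp only: sum_dyadic_blocks[where G = "\<lambda>_ j. ?t n j"] sum_distrib_left) simp
    finally have "?D * (\<Sum>k<2^(n+r). norm (?x (n+r) k - ?x n (k div 2^r)))
       \<le> ?D * (2^(n+r) * \<eta> + C * (\<Sum>k<2^(n+r). arclen_gap (?x n (k div 2^r)) (?x (n+r) k))
        + 2 * (2^r * (\<Sum>k<2^n. ?t n k)) + 2 * (\<Sum>k<2^(n+r). ?t (n + r) k))"
      using \<open>T > 0\<close> by (intro mult_left_mono) auto
    also have "\<dots> = T * \<eta> + C * (?D * (\<Sum>k<2^(n+r). arclen_gap (?x n (k div 2^r)) (?x (n+r) k)))
       + 2 * tail K n + 2 * tail K (n + r)"
      unfolding tail_def by (simp only: distrib_left) (simp add: power_add mult.left_commute)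
    also have "\<dots> = T * \<eta> + C * (L (n + r) - L n) + 2 * tail K n + 2 * tail K (n + r)"
      unfolding gap ..
    also have "\<dots> < e / 8 + e / 8 + 2 * (e / 8) + 2 * (e / 8)"
    proof -
      have "L (n + r) - L n < e / (8 * C)"
        using N1[of "n + r" n] n by simp
      then have "C * (L (n + r) - L n) < C * (e / (8 * C))"
        using \<open>C > 0\<close> by (rule mult_strict_left_mono)
      then have "C * (L (n + r) - L n) < e / 8"
        using \<open>C > 0\<close> by simp
      moreover have "T * \<eta> = e / 8"
        using \<open>T > 0\<close> by (simp add: \<eta>_def)
      ultimately show ?thesis
        using tail[of n] tail[of "n + r"] n by simp
    qed
    also have "\<dots> < e"
      using \<open>e > 0\<close> by simp
    finally show ?thesis .
  qed
  then show ?thesis by blast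
qed

section \<open>Passage to the limit of the slopes\<close>

lemma AC_continuous_on:
  assumes "AC w"
  shows "continuous_on {0..} w"
  unfolding continuous_on_iff
proof (intro ballI allI impI)
  fix x e :: real assume "x \<in> {0..}" "0 < e"
  then have "x + 1 > 0" by simp
  obtain \<delta> where "\<delta> > 0" and ac: "\<forall>(m::nat) a b.
        (\<forall>k<m. 0 \<le> a k \<and> a k \<le> b k \<and> b k \<le> x + 1) \<and>
        disjoint_family_on (\<lambda>k. {a k<..<b k}) {..<m} \<and>
        (\<Sum>k<m. b k - a k) < \<delta> \<longrightarrow>
        (\<Sum>k<m. norm (w (b k) - w (a k))) < e"
    using assms[unfolded AC_def, rule_format, OF \<open>x + 1 > 0\<close> \<open>0 < e\<close>] by auto
  have "dist (w y) (w x) < e" if "y \<in> {0..}" "dist y x < min \<delta> 1" for y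
  proof -
    have "(\<Sum>k<1::nat. norm (w (max x y) - w (min x y))) < e"
      using that \<open>x \<in> {0..}\<close>
      by (intro ac[rule_format, of 1 "\<lambda>_. min x y" "\<lambda>_. max x y"])
        (auto simp: dist_real_def disjoint_family_on_def)
    then show ?thesis
      by (auto simp: dist_norm max_def min_def norm_minus_commute split: if_splits)
  qed
  then show "\<exists>d>0. \<forall>y\<in>{0..}. dist y x < d \<longrightarrow> dist (w y) (w x) < e"
    using \<open>\<delta> > 0\<close> by (intro exI[of _ "min \<delta> 1"]) auto
qed

lemma sum_dslope: "(\<Sum>i<K. dslope w T n i) = (2^n / T) *\<^sub>R (w (T * real K / 2^n) - w 0)"
  unfolding dslope_def scaleR_sum_right[symmetric]
  by (subst sum_lessThan_telescope[of "\<lambda>i. w (T * real i / 2^n)" K]) simp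

text \<open>At a grid point of level n every finer step function integrates exactly to the increment
  of \<open>w\<close>. The L^1 limit inherits this, and density of the grid points together with
  continuity of both sides extends it to the whole interval.\<close>

lemma AC_imp_indefinite_integral_on:
  fixes w :: "real \<Rightarrow> real^'n"
  assumes "AC w" "T > 0"
  obtains f where "f absolutely_integrable_on {0..T}"
    "\<And>t. t \<in> {0..T} \<Longrightarrow> integral {0..t} f = w t - w 0"
proof -
  let ?M = "lebesgue_on {0..T}"
  define d where "d n = T / 2^n" for n
  have d: "d n > 0" for n
    using \<open>T > 0\<close> by (simp add: d_def)
  have d_T: "d n * real (2^n) = T" for n
    by (simp add: d_def)
  define f where "f n t = dslope w T n (nat \<lfloor>t / d n\<rfloor>)" for n t
  have f_int: "f n absolutely_integrable_on {0..T}" for n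
  proof (rule absolutely_integrable_onI)
    show "f n integrable_on {0..T}"
      using has_integral_step[OF d, of "dslope w T n" n "2^n"] unfolding d_T f_def by blast
    show "(\<lambda>t. norm (f n t)) integrable_on {0..T}"
      using has_integral_step[OF d, of "\<lambda>k. norm (dslope w T n k)" n "2^n"] unfolding d_T f_def by blast
  qed
  have f_leb: "integrable ?M (f n)" for n
    by (rule absolutely_integrable_imp_integrable[OF f_int]) simp
  \<comment> \<open>Reading the coarse slope off the fine cell index makes the difference of two
    levels a step function of the finer level.\<close>
  have f_coarse: "f n t = dslope w T n (nat \<lfloor>t / d (n + r)\<rfloor> div 2^r)" if "t \<ge> 0" for n r t
  proof -
    have "\<lfloor>t / d n\<rfloor> = \<lfloor>(t / d (n + r)) / real_of_int (2^r)\<rfloor>"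
      using \<open>T > 0\<close> by (simp add: d_def power_add field_simps)
    also have "\<dots> = \<lfloor>t / d (n + r)\<rfloor> div 2^r"
      by (rule floor_divide_real_eq_div) simp
    finally show ?thesis
      using that d[of "n + r"] by (simp add: f_def nat_div_distrib nat_power_eq)
  qed
  have f_diff: "(LINT t|?M. norm (f (n + r) t - f n t))
      = d (n + r) * (\<Sum>k<2^(n+r). norm (dslope w T (n+r) k - dslope w T n (k div 2^r)))" for n r
  proof -
    let ?\<phi> = "\<lambda>k. norm (dslope w T (n+r) k - dslope w T n (k div 2^r))"
    have "(LINT t|?M. norm (f (n + r) t - f n t)) = integral {0..T} (\<lambda>t. norm (f (n + r) t - f n t))"
      by (intro lebesgue_integral_eq_integral integrable_norm Bochner_Integration.integrable_diff f_leb) simp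
    also have "\<dots> = integral {0..T} (\<lambda>t. ?\<phi> (nat \<lfloor>t / d (n + r)\<rfloor>))"
      by (intro integral_cong) (simp add: f_coarse[of _ n r] f_def[of "n + r"])
    also have "\<dots> = d (n + r) * (\<Sum>k<2^(n+r). ?\<phi> k)"
      using has_integral_step[OF d, of ?\<phi> "n + r" "2^(n+r)"] unfolding d_T by (simp add: integral_unique)
    finally show ?thesis .
  qed
  have cauchy: "\<exists>N. \<forall>i\<ge>N. \<forall>j\<ge>N. (LINT t|?M. norm (f i t - f j t)) < e" if "e > 0" for e
  proof -
    obtain N where N: "\<And>n r. n \<ge> N \<Longrightarrow> (LINT t|?M. norm (f (n + r) t - f n t)) < e"
      using dslope_L1_Cauchy[OF assms \<open>e > 0\<close>] unfolding f_diff d_def by blast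
    have "(LINT t|?M. norm (f i t - f j t)) < e" if "i \<ge> N" "j \<ge> N" for i j
    proof (cases "i \<ge> j")
      case True
      then show ?thesis using N[of j "i - j"] that by simp
    next
      case False
      then show ?thesis using N[of i "j - i"] that by (simp add: norm_minus_commute)
    qed
    then show ?thesis by blast
  qed
  obtain g where g: "integrable ?M g" and lim: "(\<lambda>n. LINT t|?M. norm (f n t - g t)) \<longlonglongrightarrow> 0"
    using L1_Cauchy_imp_L1_convergent[OF f_leb cauchy] by blast
  have g_abs: "g absolutely_integrable_on {0..T}"
    using g by (simp add: set_integrable_def integrable_restrict_space)
  have lim_int: "(\<lambda>n. integral {0..t} (f n)) \<longlonglongrightarrow> integral {0..t} g" if "t \<in> {0..T}" for t
  proof (rule LIMSEQ_I)
    fix e :: real assume "e > 0"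
    then obtain N where N: "\<And>n. n \<ge> N \<Longrightarrow> norm ((LINT t|?M. norm (f n t - g t)) - 0) < e"
      using LIMSEQ_D[OF lim] by blast
    have "norm (integral {0..t} (f n) - integral {0..t} g) < e" if "n \<ge> N" for n
    proof -
      have dif: "(\<lambda>s. f n s - g s) absolutely_integrable_on {0..T}"
        by (rule set_integral_diff(1)[OF f_int g_abs])
      have dif_t: "(\<lambda>s. f n s - g s) absolutely_integrable_on {0..t}"
        using dif \<open>t \<in> {0..T}\<close> by (elim absolutely_integrable_on_subinterval) auto
      have "f n absolutely_integrable_on {0..t}" "g absolutely_integrable_on {0..t}"
        using f_int[of n] g_abs \<open>t \<in> {0..T}\<close> by (auto elim!: absolutely_integrable_on_subinterval)
      then have "integral {0..t} (f n) - integral {0..t} g = integral {0..t} (\<lambda>s. f n s - g s)"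
        by (intro Henstock_Kurzweil_Integration.integral_diff[symmetric] set_lebesgue_integral_eq_integral(1))
      also have "norm \<dots> \<le> integral {0..t} (\<lambda>s. norm (f n s - g s))"
        using dif_t by (intro integral_norm_bound_integral) (auto simp: absolutely_integrable_on_def)
      also have "\<dots> \<le> integral {0..T} (\<lambda>s. norm (f n s - g s))"
        using dif dif_t \<open>t \<in> {0..T}\<close> by (intro integral_subset_le) (auto simp: absolutely_integrable_on_def)
      also have "\<dots> = (LINT t|?M. norm (f n t - g t))"
        by (intro lebesgue_integral_eq_integral[symmetric] integrable_norm Bochner_Integration.integrable_diff f_leb g) simp
      also have "\<dots> < e"
        using N[OF that] by simp
      finally show ?thesis .
    qed
    then show "\<exists>no. \<forall>n\<ge>no. norm (integral {0..t} (f n) - integral {0..t} g) < e" by blast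
  qed
  have dyadic: "integral {0..d n * real k} g = w (d n * real k) - w 0" if "k \<le> 2^n" for n k
  proof -
    have "integral {0..d n * real k} (f (n + r)) = w (d n * real k) - w 0" for r
    proof -
      have eq: "d (n + r) * real (k * 2^r) = d n * real k" "T * real (k * 2^r) / 2^(n+r) = d n * real k"
        by (simp_all add: d_def power_add)
      have "integral {0..d n * real k} (f (n + r)) = d (n + r) *\<^sub>R (\<Sum>i<k*2^r. dslope w T (n+r) i)"
        using has_integral_step[OF d, of "dslope w T (n+r)" "n + r" "k*2^r"]
        unfolding eq f_def by (rule integral_unique)
      also have "\<dots> = w (d n * real k) - w 0"
        unfolding sum_dslope eq using \<open>T > 0\<close> by (simp add: d_def)
      finally show ?thesis .
    qed
    moreover have "(\<lambda>r. integral {0..d n * real k} (f (r + n))) \<longlonglongrightarrow> integral {0..d n * real k} g"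
    proof (rule LIMSEQ_ignore_initial_segment[OF lim_int])
      have "d n * real k \<le> d n * real (2^n)"
        using that d[of n] by (intro mult_left_mono) (simp_all flip: of_nat_le_iff)
      then show "d n * real k \<in> {0..T}"
        using \<open>T > 0\<close> by (simp add: d_def)
    qed
    ultimately show ?thesis
      by (simp add: add.commute LIMSEQ_const_iff)
  qed
  show ?thesis
  proof
    show "g absolutely_integrable_on {0..T}" by fact
    fix t assume t: "t \<in> {0..T}"
    \<comment> \<open>The last grid point of level \<open>n\<close> that does not exceed t.\<close>
    define x where "x n = d n * real (nat \<lfloor>t / d n\<rfloor>)" for n
    have near: "0 \<le> x n" "x n \<le> t" "t - d n \<le> x n" for n
    proof -
      have "t / d n \<ge> 0"
        using t d[of n] by simp
      then have "real (nat \<lfloor>t / d n\<rfloor>) \<le> t / d n" "t / d n - 1 \<le> real (nat \<lfloor>t / d n\<rfloor>)"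
        by linarith+
      from this[THEN mult_left_mono, of "d n"] show "0 \<le> x n" "x n \<le> t" "t - d n \<le> x n"
        using d[of n] by (simp_all add: x_def right_diff_distrib)
    qed
    have "(\<lambda>n. t - T * (1/2)^n) \<longlonglongrightarrow> t - T * 0"
      by (intro tendsto_intros LIMSEQ_power_zero) simp
    then have "(\<lambda>n. t - d n) \<longlonglongrightarrow> t"
      by (simp add: d_def power_divide)
    then have x: "x \<longlonglongrightarrow> t"
      using near by (intro tendsto_sandwich[of "\<lambda>n. t - d n" x sequentially "\<lambda>_. t"]) auto
    have x_in: "x n \<in> {0..T}" for n
      using near[of n] t by auto
    have eq: "integral {0..x n} g = w (x n) - w 0" for n
    proof -
      have "nat \<lfloor>t / d n\<rfloor> \<le> 2^n"
      proof -
        have "t / d n \<le> 2^n"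
          using t d[of n] d_T[of n] by (simp add: pos_divide_le_eq mult.commute)
        then have "\<lfloor>t / d n\<rfloor> \<le> 2^n"
          by (simp add: floor_le_iff)
        then show ?thesis by (simp add: nat_le_iff)
      qed
      then show ?thesis
        unfolding x_def by (rule dyadic)
    qed
    have "continuous_on {0..T} (\<lambda>t. integral {0..t} g)"
      using g_abs by (intro indefinite_integral_continuous_1 set_lebesgue_integral_eq_integral(1))
    then have "(\<lambda>n. integral {0..x n} g) \<longlonglongrightarrow> integral {0..t} g"
      using x x_in t by (auto simp: continuous_on_sequentially o_def)
    moreover have "(\<lambda>n. w (x n) - w 0) \<longlonglongrightarrow> w t - w 0"
      using AC_continuous_on[OF \<open>AC w\<close>] x near t
      by (intro tendsto_intros) (auto simp: continuous_on_sequentially o_def)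
    ultimately show "integral {0..t} g = w t - w 0"
      unfolding eq by (rule LIMSEQ_unique)
  qed
qed

text \<open>The point 0 is null, and removing it matches the hypotheses, which speak about positive
  arguments only.\<close>

lemma AE_lebesgue_on_nonneg_iff:
  "(AE t in lebesgue_on {0::real..}. P t) \<longleftrightarrow> (AE t in lebesgue. t > 0 \<longrightarrow> P t)"
proof -
  have ne: "AE t in lebesgue. t \<noteq> (0::real)"
    using AE_lborel_singleton[of "0::real"] by (rule AE_completion)
  have "(AE t in lebesgue. t > 0 \<longrightarrow> P t) \<longleftrightarrow> (AE t in lebesgue. t \<in> {0..} \<longrightarrow> P t)"
  proof
    assume "AE t in lebesgue. t > 0 \<longrightarrow> P t"
    with ne show "AE t in lebesgue. t \<in> {0..} \<longrightarrow> P t"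
      by eventually_elim auto
  qed (auto elim: eventually_mono)
  then show ?thesis
    by (simp add: AE_restrict_space_iff)
qed

section \<open>Differentiation of indefinite integrals\<close>

text \<open>Split \<open>g\<close> at height \<open>K\<close>. By dominated convergence the part
  above \<open>K\<close> has integral below \<open>e / 2\<close> for a suitable \<open>K\<close>,
  whatever the intervals; the bounded part contributes at most \<open>K\<close> times their total
  length.\<close>

lemma AC_indefinite_integral:
  fixes g :: "real \<Rightarrow> real^'n"
  assumes "locally_integrable g"
  shows "AC (\<lambda>t. integral {0..t} g)"
  unfolding AC_def
proof (intro allI impI)
  fix T e :: real assume "T > 0" "e > 0"
  let ?M = "lebesgue_on {0..T}"
  have g: "g absolutely_integrable_on {0..T}"
    using assms \<open>T > 0\<close> by (simp add: locally_integrable_def)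
  then have gM: "integrable ?M g"
    by (rule absolutely_integrable_imp_integrable) simp
  define h where "h K t = (if norm (g t) \<le> real K then 0 else norm (g t))" for K t
  have [measurable]: "g \<in> borel_measurable ?M"
    using gM by (rule borel_measurable_integrable)
  have hm[measurable]: "h K \<in> borel_measurable ?M" for K
    unfolding h_def by measurable
  have h_int: "integrable ?M (h K)" for K
    by (rule Bochner_Integration.integrable_bound[OF integrable_norm[OF gM]]) (auto simp: h_def)
  have "(\<lambda>K. LINT t|?M. h K t) \<longlonglongrightarrow> (LINT t|?M. 0)"
  proof (rule integral_dominated_convergence[where w = "\<lambda>t. norm (g t)"])
    show "AE t in ?M. (\<lambda>K. h K t) \<longlonglongrightarrow> 0"
    proof (intro AE_I2 tendsto_eventually)
      fix t
      obtain K0 where "norm (g t) \<le> real K0"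
        using real_arch_simple by blast
      then show "\<forall>\<^sub>F K in sequentially. h K t = 0"
        by (intro eventually_sequentiallyI[of K0]) (auto simp: h_def)
    qed
    show "integrable ?M (\<lambda>t. norm (g t))"
      by (rule integrable_norm[OF gM])
  qed (auto simp: h_def)
  then have "\<forall>\<^sub>F K in sequentially. (LINT t|?M. h K t) < e / 2"
    using \<open>e > 0\<close> by (intro order_tendstoD(2)[of _ "LINT t|?M. 0"]) auto
  then obtain K where K: "(LINT t|?M. h K t) < e / 2"
    using eventually_happens'[OF sequentially_bot] by blast
  have h: "h K absolutely_integrable_on {0..T}"
    using h_int[of K] by (simp add: set_integrable_def integrable_restrict_space)
  \<comment> \<open>The summand 1 covers the case \<open>K = 0\<close>.\<close>
  define \<delta> where "\<delta> = e / (2 * (real K + 1))"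
  have "\<delta> > 0" using \<open>e > 0\<close> by (simp add: \<delta>_def)
  show "\<exists>\<delta>>0. \<forall>(m::nat) a b. (\<forall>k<m. 0 \<le> a k \<and> a k \<le> b k \<and> b k \<le> T) \<and>
        disjoint_family_on (\<lambda>k. {a k<..<b k}) {..<m} \<and> (\<Sum>k<m. b k - a k) < \<delta> \<longrightarrow>
        (\<Sum>k<m. norm (integral {0..b k} g - integral {0..a k} g)) < e"
  proof (intro exI[of _ \<delta>] conjI allI impI \<open>\<delta> > 0\<close>, elim conjE)
    fix m :: nat and a b
    assume ab: "\<forall>k<m. 0 \<le> a k \<and> a k \<le> b k \<and> b k \<le> T"
      and disj: "disjoint_family_on (\<lambda>k. {a k<..<b k}) {..<m}"
      and small: "(\<Sum>k<m. b k - a k) < \<delta>"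
    let ?I = "\<lambda>k. {a k<..<b k}"
    have h_I: "h K absolutely_integrable_on ?I k" if "k < m" for k
      using h by (rule set_integrable_subset) (use ab that in \<open>auto intro: order_trans less_imp_le\<close>)
    have est: "norm (integral {0..b k} g - integral {0..a k} g)
        \<le> real K * (b k - a k) + (LINT t:?I k|lebesgue. h K t)" if "k < m" for k
    proof -
      have le: "0 \<le> a k" "a k \<le> b k" "b k \<le> T"
        using ab that by auto
      have gs: "g integrable_on {0..b k}" "g absolutely_integrable_on {a k..b k}"
        "h K absolutely_integrable_on {a k..b k}"
        using g h le
        by (auto intro!: set_lebesgue_integral_eq_integral(1) elim!: absolutely_integrable_on_subinterval)
      have hi: "h K integrable_on {a k..b k}"
        by (intro set_lebesgue_integral_eq_integral(1) gs)
      have "integral {0..b k} g - integral {0..a k} g = integral {a k..b k} g"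
        using Henstock_Kurzweil_Integration.integral_combine[OF le(1,2) gs(1)] by (simp add: algebra_simps)
      also have "norm \<dots> \<le> integral {a k..b k} (\<lambda>t. real K + h K t)"
      proof (rule integral_norm_bound_integral)
        show "g integrable_on {a k..b k}"
          by (rule set_lebesgue_integral_eq_integral(1)[OF gs(2)])
        show "(\<lambda>t. real K + h K t) integrable_on {a k..b k}"
          using hi by (intro integrable_add) auto
      qed (auto simp: h_def)
      also have "\<dots> = real K * (b k - a k) + integral {a k..b k} (h K)"
        using hi le by (subst Henstock_Kurzweil_Integration.integral_add) auto
      \<comment> \<open>Only the open intervals are disjoint, so the integrals are moved there
        before they are added up.\<close>
      also have "integral {a k..b k} (h K) = integral {a k<..<b k} (h K)"
        using integral_open_interval_real by metis
      also have "\<dots> = (LINT t:?I k|lebesgue. h K t)"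
        by (intro set_lebesgue_integral_eq_integral(2)[symmetric] h_I that)
      finally show ?thesis .
    qed
    have U: "(\<Union>k<m. ?I k) \<subseteq> {0..T}"
      using ab by (auto intro: order_trans less_imp_le)
    have "(\<Sum>k<m. norm (integral {0..b k} g - integral {0..a k} g))
        \<le> (\<Sum>k<m. real K * (b k - a k) + (LINT t:?I k|lebesgue. h K t))"
      using est by (intro sum_mono) auto
    also have "\<dots> = real K * (\<Sum>k<m. b k - a k) + (LINT t:(\<Union>k<m. ?I k)|lebesgue. h K t)"
      by (subst set_integral_finite_Union) (auto simp: sum.distrib sum_distrib_left disj h_I)
    also have "(LINT t:(\<Union>k<m. ?I k)|lebesgue. h K t) \<le> (LINT t:{0..T}|lebesgue. h K t)"
      unfolding set_lebesgue_integral_def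
    proof (rule integral_mono)
      show "integrable lebesgue (\<lambda>t. indicat_real (\<Union>k<m. ?I k) t *\<^sub>R h K t)"
        using set_integrable_subset[OF h _ U] by (auto simp: set_integrable_def)
      show "integrable lebesgue (\<lambda>t. indicat_real {0..T} t *\<^sub>R h K t)"
        using h by (simp add: set_integrable_def)
      show "indicat_real (\<Union>k<m. ?I k) t *\<^sub>R h K t \<le> indicat_real {0..T} t *\<^sub>R h K t" for t
        using subsetD[OF U, of t] by (simp add: indicator_def h_def)
    qed
    also have "(LINT t:{0..T}|lebesgue. h K t) = (LINT t|?M. h K t)"
      by (simp add: set_lebesgue_integral_def integral_restrict_space)
    also have "real K * (\<Sum>k<m. b k - a k) + (LINT t|?M. h K t) < e / 2 + e / 2"
    proof (rule add_le_less_mono[OF _ K])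
      have "real K * (\<Sum>k<m. b k - a k) \<le> real K * \<delta>"
        using small by (intro mult_left_mono) auto
      also have "\<dots> \<le> (real K + 1) * \<delta>"
        using \<open>\<delta> > 0\<close> by (intro mult_right_mono) auto
      also have "\<dots> = e / 2"
        by (simp add: \<delta>_def field_simps)
      finally show "real K * (\<Sum>k<m. b k - a k) \<le> e / 2" .
    qed
    finally show "(\<Sum>k<m. norm (integral {0..b k} g - integral {0..a k} g)) < e" by simp
  qed
qed

text \<open>\<open>integrable_ccontinuous_explicit\<close> controls averages over
  \<open>{x..x + h}\<close>, that is, the derivative from the right. The derivative from the left is
  the same statement for the reflected function.\<close>

lemma Lebesgue_differentiation:
  fixes g :: "real \<Rightarrow> real^'n"
  assumes "locally_integrable g"
  shows "AE t in lebesgue. t > 0 \<longrightarrow> ((\<lambda>t. integral {0..t} g) has_vector_derivative g t) (at t)"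
proof -
  \<comment> \<open>Extension by 0 yields a function integrable on every bounded interval of the
    line, which the averages and the reflection call for.\<close>
  define G where "G t = (if t \<ge> 0 then g t else 0)" for t
  have g_int: "g integrable_on {0..T}" for T
  proof -
    consider "T > 0" | "T = 0" | "T < 0" by linarith
    then show ?thesis
    proof cases
      case 1
      then show ?thesis
        using assms by (auto simp: locally_integrable_def intro: set_lebesgue_integral_eq_integral(1))
    next
      case 2
      then show ?thesis
        using integrable_on_refl[of g "0::real"] by simp
    next
      case 3
      then have "{0..T} = {}" by simp
      then show ?thesis
        by (simp only: integrable_on_empty)
    qed
  qed
  have G_int: "G integrable_on {a..b}" for a b
  proof -
    have left: "G integrable_on {-\<bar>a\<bar>..0}"
      by (rule integrable_spike[of "\<lambda>_. 0" _ "{0}"]) (auto simp: G_def)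
    have right: "G integrable_on {0..\<bar>b\<bar>}"
      using g_int by (rule integrable_eq) (simp add: G_def)
    have "G integrable_on {-\<bar>a\<bar>..\<bar>b\<bar>}"
      by (rule Henstock_Kurzweil_Integration.integrable_combine[OF _ _ left right]) auto
    then show ?thesis
      by (rule integrable_on_subinterval) auto
  qed
  have G_refl: "(\<lambda>x. G (- x)) integrable_on {a..b}" for a b
    using G_int[of "-b" "-a"] Henstock_Kurzweil_Integration.integrable_reflect_real[where f = G and a = "-b" and b = "-a"] by simp
  have right_lim: "\<exists>N. negligible N \<and> (\<forall>x e. x \<notin> N \<longrightarrow> 0 < e \<longrightarrow>
      (\<exists>d>0. \<forall>h. 0 < h \<and> h < d \<longrightarrow> norm (integral {x..x + h} f /\<^sub>R h - f x) < e))"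
    if f: "\<And>a b. f integrable_on {a..b}" for f :: "real \<Rightarrow> real^'n"
  proof -
    obtain N where "negligible N" and N: "\<And>x e. \<lbrakk>x \<notin> N; 0 < e\<rbrakk> \<Longrightarrow>
      \<exists>d>0. \<forall>h. 0 < h \<and> h < d \<longrightarrow> norm (integral (cbox x (x + h *\<^sub>R One)) f /\<^sub>R h ^ DIM(real) - f x) < e"
      by (rule integrable_ccontinuous_explicit[of f]) (use f in \<open>simp_all add: cbox_interval\<close>)
    have [simp]: "cbox x (x + h *\<^sub>R One) = {x..x + h}" for x h :: real
      by (simp add: cbox_interval)
    show ?thesis
    proof (intro exI[of _ N] conjI allI impI)
      fix x and e :: real assume "x \<notin> N" "0 < e"
      from N[OF this] show "\<exists>d>0. \<forall>h. 0 < h \<and> h < d \<longrightarrow> norm (integral {x..x + h} f /\<^sub>R h - f x) < e"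
        by simp
    qed fact
  qed
  obtain N1 where "negligible N1" and N1: "\<And>x e. \<lbrakk>x \<notin> N1; 0 < e\<rbrakk> \<Longrightarrow>
      \<exists>d>0. \<forall>h. 0 < h \<and> h < d \<longrightarrow> norm (integral {x..x + h} G /\<^sub>R h - G x) < e"
    using right_lim[of G, OF G_int] by blast
  obtain N2 where "negligible N2" and N2: "\<And>x e. \<lbrakk>x \<notin> N2; 0 < e\<rbrakk> \<Longrightarrow>
      \<exists>d>0. \<forall>h. 0 < h \<and> h < d \<longrightarrow> norm (integral {x..x + h} (\<lambda>x. G (- x)) /\<^sub>R h - G (- x)) < e"
    using right_lim[of "\<lambda>x. G (- x)", OF G_refl] by blast
  define N where "N = N1 \<union> uminus ` N2"
  have "negligible N"
    unfolding N_def using \<open>negligible N1\<close> \<open>negligible N2\<close>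
    by (intro negligible_Un negligible_differentiable_image_negligible)
      (auto intro!: derivative_intros simp: differentiable_on_def)
  have int_diff: "integral {0..b} g - integral {0..a} g = integral {a..b} G" if "0 \<le> a" "a \<le> b" for a b
  proof -
    have "integral {a..b} G = integral {a..b} g"
      using that by (intro integral_cong) (auto simp: G_def)
    then show ?thesis
      using Henstock_Kurzweil_Integration.integral_combine[OF that g_int] by (simp add: algebra_simps)
  qed
  have "((\<lambda>t. integral {0..t} g) has_vector_derivative g t) (at t)" if "t \<notin> N" "t > 0" for t
    unfolding has_vector_derivative_def has_derivative_at_alt
  proof (intro conjI allI impI bounded_linear_scaleR_left)
    fix e :: real assume "e > 0"
    have "t \<notin> N1" "- t \<notin> N2"
      using \<open>t \<notin> N\<close> image_eqI[of t uminus "- t" N2] by (auto simp: N_def)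
    obtain d1 where "d1 > 0" and d1: "\<And>h. 0 < h \<Longrightarrow> h < d1 \<Longrightarrow> norm (integral {t..t + h} G /\<^sub>R h - G t) < e"
      using N1[OF \<open>t \<notin> N1\<close> \<open>e > 0\<close>] by blast
    obtain d2 where "d2 > 0" and d2: "\<And>h. 0 < h \<Longrightarrow> h < d2
        \<Longrightarrow> norm (integral {- t..- t + h} (\<lambda>x. G (- x)) /\<^sub>R h - G t) < e"
      using N2[OF \<open>- t \<notin> N2\<close> \<open>e > 0\<close>] unfolding minus_minus by blast
    have scale: "norm (I - h *\<^sub>R G t) \<le> e * h" if "h > 0" "norm (I /\<^sub>R h - G t) < e" for h I
    proof -
      have "I - h *\<^sub>R G t = h *\<^sub>R (I /\<^sub>R h - G t)"
        using that by (simp add: scaleR_diff_right)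
      then show ?thesis
        using that by (simp add: mult.commute)
    qed
    have "norm (integral {0..y} g - integral {0..t} g - (y - t) *\<^sub>R g t) \<le> e * norm (y - t)"
      if y: "norm (y - t) < min t (min d1 d2)" for y
    proof -
      have gt: "G t = g t"
        using \<open>t > 0\<close> by (simp add: G_def)
      consider "y = t" | "y > t" | "y < t" by linarith
      then show ?thesis
      proof cases
        case 2
        then show ?thesis
          using scale[OF _ d1, of "y - t"] int_diff[of t y] y \<open>t > 0\<close> gt by simp
      next
        case 3
        have "integral {- t..- t + (t - y)} (\<lambda>x. G (- x)) = integral {y..t} G"
          using Henstock_Kurzweil_Integration.integral_reflect_real[where f = G and a = y and b = t] by simp
        also have "\<dots> = integral {0..t} g - integral {0..y} g"
          using 3 y by (intro int_diff[symmetric]) (auto simp: abs_if split: if_splits)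
        finally have "norm (integral {0..t} g - integral {0..y} g - (t - y) *\<^sub>R g t) \<le> e * (t - y)"
          using scale[OF _ d2, of "t - y"] 3 y gt by simp
        moreover have "integral {0..y} g - integral {0..t} g - (y - t) *\<^sub>R g t
            = - (integral {0..t} g - integral {0..y} g - (t - y) *\<^sub>R g t)"
          by (simp add: algebra_simps)
        ultimately show ?thesis
          using 3 by (simp only: norm_minus_cancel) simp
      qed simp
    qed
    then show "\<exists>d>0. \<forall>y. norm (y - t) < d \<longrightarrow>
        norm (integral {0..y} g - integral {0..t} g - (y - t) *\<^sub>R g t) \<le> e * norm (y - t)"
      using \<open>t > 0\<close> \<open>d1 > 0\<close> \<open>d2 > 0\<close> by (intro exI[of _ "min t (min d1 d2)"]) auto
  qed
  then show ?thesis
    unfolding eventually_ae_filter_negligible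
    using \<open>negligible N\<close> by (intro exI[of _ N]) auto
qed

section \<open>Absolutely continuous representatives and the operator D\<close>

lemma continuous_AE_eq_imp_eq:
  fixes f g :: "real \<Rightarrow> 'a::real_normed_vector"
  assumes "continuous_on {0..} f" "continuous_on {0..} g"
    and "AE t in lebesgue. t > 0 \<longrightarrow> f t = g t" and "t \<ge> 0"
  shows "f t = g t"
proof -
  \<comment> \<open>This set is open by continuity and null by assumption, hence empty; the point 0
    is then reached by closure.\<close>
  let ?D = "{0<..} \<inter> (\<lambda>t. f t - g t) -` (- {0})"
  have cont: "continuous_on {0..} (\<lambda>t. f t - g t)"
    using assms by (intro continuous_intros)
  then have "continuous_on {0<..} (\<lambda>t. f t - g t)"
    by (rule continuous_on_subset) auto
  then have "open ?D"
    by (intro continuous_open_preimage) auto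
  moreover have "negligible ?D"
    using assms(3) unfolding eventually_ae_filter_negligible
    by (elim exE conjE negligible_subset) auto
  ultimately have "?D = {}"
    using open_not_negligible by blast
  then have eq: "f s - g s = 0" if "s \<in> {0<..}" for s
    using that by auto
  have "f t - g t = 0"
    by (rule continuous_constant_on_closure[of "{0<..}" "\<lambda>t. f t - g t", OF _ eq])
      (use cont \<open>t \<ge> 0\<close> in \<open>auto simp: closure_greaterThan\<close>)
  then show ?thesis by simp
qed

text \<open>All candidates for the choice in \<open>AC_rep\<close> agree on [0,\<infinity>[ by
  continuity, so a known representative may replace the chosen one there. At negative arguments the
  choice stays arbitrary.\<close>

lemma AC_rep_eq:
  assumes "AC U" "AE t in lebesgue. t > 0 \<longrightarrow> U t = u t" "t \<ge> 0"
  shows "AC_rep u t = U t"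
proof -
  have "AC (AC_rep u) \<and> (AE t in lebesgue_on {0..}. AC_rep u t = u t)"
    unfolding AC_rep_def
    by (rule someI[of _ U]) (use assms in \<open>simp add: AE_lebesgue_on_nonneg_iff\<close>)
  then have "AC (AC_rep u)" and "AE t in lebesgue. t > 0 \<longrightarrow> AC_rep u t = u t"
    by (auto simp: AE_lebesgue_on_nonneg_iff)
  moreover from this(2) assms(2) have "AE t in lebesgue. t > 0 \<longrightarrow> AC_rep u t = U t"
    by eventually_elim auto
  ultimately show ?thesis
    using continuous_AE_eq_imp_eq AC_continuous_on assms by blast
qed

lemma D_op_indefinite_integral:
  assumes "locally_integrable g" "AE t in lebesgue. t > 0 \<longrightarrow> u t = integral {0..t} g"
  shows "AE t in lebesgue. t > 0 \<longrightarrow> D_op u t = g t"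
proof -
  have "AE t in lebesgue. t > 0 \<longrightarrow> integral {0..t} g = u t"
    using assms(2) by eventually_elim auto
  then have rep: "AC_rep u t = integral {0..t} g" if "t \<ge> 0" for t
    using that by (intro AC_rep_eq AC_indefinite_integral assms(1)) auto
  show ?thesis
    using Lebesgue_differentiation[OF assms(1)]
  proof eventually_elim
    case (elim t)
    show ?case
    proof
      assume "t > 0"
      with elim have "((\<lambda>t. integral {0..t} g) has_vector_derivative g t) (at t)"
        by simp
      then have "(AC_rep u has_vector_derivative g t) (at t)"
        \<comment> \<open>The two-sided derivative at t > 0 sees only the open half-line, where the
          representative is known.\<close>
        by (rule has_vector_derivative_transform_within_open[of _ _ _ "{0<..}"])
          (use \<open>t > 0\<close> rep in auto)
      then show "D_op u t = g t"
        unfolding D_op_def by (rule vector_derivative_at)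
    qed
  qed
qed

text \<open>This allows differentiation of the integral of a density that is known on one bounded
  interval only.\<close>

lemma locally_integrable_truncate:
  assumes "f absolutely_integrable_on {0..T}"
  shows "locally_integrable (\<lambda>t. if t \<le> T then f t else 0)"
  unfolding locally_integrable_def
proof (intro allI impI)
  fix S :: real assume "S > 0"
  have "(\<lambda>t. if t \<in> {0..T} then f t else 0) absolutely_integrable_on UNIV"
    using assms by (simp only: absolutely_integrable_restrict_UNIV)
  then have "(\<lambda>t. if t \<in> {0..T} then f t else 0) absolutely_integrable_on {0..S}"
    by (rule absolutely_integrable_on_subinterval) simp
  then show "(\<lambda>t. if t \<le> T then f t else 0) absolutely_integrable_on {0..S}"
    by (rule absolutely_integrable_spike[OF _ negligible_empty]) simp
qed

text \<open>The densities found on different intervals need not agree pointwise. The derivative of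
  \<open>w\<close> serves as a common one: it equals each of them almost everywhere on its interval,
  and its arbitrary values where \<open>w\<close> is not differentiable fill only a null
  set.\<close>

lemma AC_imp_indefinite_integral:
  assumes "AC w"
  obtains f where "locally_integrable f" "\<And>t. t \<ge> 0 \<Longrightarrow> w t = w 0 + integral {0..t} f"
proof -
  define f where "f t = vector_derivative w (at t)" for t
  have *: "f absolutely_integrable_on {0..T} \<and> integral {0..T} f = w T - w 0" if "T > 0" for T
  proof -
    obtain g where g: "g absolutely_integrable_on {0..T}"
      and w: "\<And>t. t \<in> {0..T} \<Longrightarrow> integral {0..t} g = w t - w 0"
      using AC_imp_indefinite_integral_on[OF assms \<open>T > 0\<close>] by blast
    let ?g = "\<lambda>t. if t \<le> T then g t else 0"
    have "AE t in lebesgue. t \<in> {0<..<T} \<longrightarrow> f t = g t"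
      using Lebesgue_differentiation[OF locally_integrable_truncate[OF g]]
    proof eventually_elim
      case (elim t)
      show ?case
      proof
        assume t: "t \<in> {0<..<T}"
        have "((\<lambda>t. w 0 + integral {0..t} ?g) has_vector_derivative 0 + ?g t) (at t)"
          using elim t by (intro has_vector_derivative_add has_vector_derivative_const) auto
        then have "(w has_vector_derivative 0 + ?g t) (at t)"
        proof (rule has_vector_derivative_transform_within_open[of _ _ _ "{0<..<T}"])
          show "w 0 + integral {0..s} ?g = w s" if "s \<in> {0<..<T}" for s
          proof -
            have "integral {0..s} ?g = integral {0..s} g"
              using that by (intro integral_cong) auto
            then show ?thesis
              using w[of s] that by simp
          qed
        qed (use t in auto)
        then have "f t = 0 + ?g t"
          unfolding f_def by (rule vector_derivative_at)
        then show "f t = g t"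
          using t by simp
      qed
    qed
    then obtain N where "negligible N" and N: "{t. \<not> (t \<in> {0<..<T} \<longrightarrow> f t = g t)} \<subseteq> N"
      unfolding eventually_ae_filter_negligible by blast
    have neg: "negligible (N \<union> {0, T})"
      using \<open>negligible N\<close> by (simp add: negligible_Un)
    have eq: "f t = g t" if "t \<in> {0..T} - (N \<union> {0, T})" for t
    proof -
      have "t \<in> {0<..<T}" "t \<notin> N"
        using that by auto
      then show ?thesis
        using N by blast
    qed
    have "f absolutely_integrable_on {0..T}"
      by (rule absolutely_integrable_spike[OF g neg eq])
    moreover have "integral {0..T} f = integral {0..T} g"
      by (rule integral_spike[OF neg]) (simp add: eq)
    ultimately show ?thesis
      using w[of T] \<open>T > 0\<close> by simp
  qed
  show ?thesis
  proof (rule that)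
    show "locally_integrable f"
      using * by (simp add: locally_integrable_def)
    show "w t = w 0 + integral {0..t} f" if "t \<ge> 0" for t
      using *[of t] that by (cases "t = 0") auto
  qed
qed

section \<open>Convolutions\<close>

lemma bounded_bilinear_matrix_vector_mult:
  "bounded_bilinear ((*v) :: real^'n^'m \<Rightarrow> real^'n \<Rightarrow> real^'m)"
  unfolding bilinear_conv_bounded_bilinear[symmetric] bilinear_def
  by (auto intro!: linearI simp: matrix_vector_right_distrib matrix_vector_mult_add_rdistrib
      matrix_scaleR_vector_ac scaleR_matrix_vector_assoc)

lemma bounded_bilinear_matrix_matrix_mult:
  "bounded_bilinear ((**) :: real^'n^'m \<Rightarrow> real^'k^'n \<Rightarrow> real^'k^'m)"
  unfolding bilinear_conv_bounded_bilinear[symmetric] bilinear_def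
  by (auto intro!: linearI simp: matrix_add_ldistrib matrix_matrix_mult_def vec_eq_iff
      sum.distrib algebra_simps sum_distrib_left)

lemma AE_lborel_affine:
  assumes "AE x in lborel. P x" "c \<noteq> 0"
  shows "AE x in lborel. P (t + c * x :: real)"
proof -
  obtain N where N: "N \<in> null_sets lborel" "{x. \<not> P x} \<subseteq> N"
    using assms(1) unfolding eventually_ae_filter by auto
  have "N \<in> sets borel"
    using N(1) by auto
  then have "AE x in lborel. t + c * x \<notin> N"
    using AE_not_in[OF N(1)] \<open>c \<noteq> 0\<close> by (intro AE_borel_affine) auto
  then show ?thesis
    using N(2) by (auto elim!: eventually_mono)
qed

lemma borel_measurable_bilinear:
  fixes prod :: "'a::{second_countable_topology, real_normed_vector}
      \<Rightarrow> 'b::{second_countable_topology, real_normed_vector} \<Rightarrow> 'c::real_normed_vector"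
  assumes "bounded_bilinear prod" "f \<in> borel_measurable M" "g \<in> borel_measurable M"
  shows "(\<lambda>x. prod (f x) (g x)) \<in> borel_measurable M"
  using assms(2,3)
  by (rule borel_measurable_continuous_Pair)
    (intro bounded_bilinear.continuous_on[OF assms(1)] continuous_intros)

text \<open>By Tonelli and translation invariance the double integral of the norms is at most
  \<open>K\<close> times the product of the two L^1 norms. The product is an arbitrary bounded
  bilinear map because matrix-vector, matrix-matrix and real products all occur, the last for
  convolutions of norms.\<close>

lemma integrable_pair_convolution:
  fixes prod :: "'a::{second_countable_topology, banach}
      \<Rightarrow> 'b::{second_countable_topology, banach} \<Rightarrow> 'c::{second_countable_topology, banach}"
  assumes "bounded_bilinear prod" "integrable lborel f" "integrable lborel g"
  shows "integrable (lborel \<Otimes>\<^sub>M lborel) (\<lambda>(t::real, s). prod (f (t - s)) (g s))"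
proof -
  interpret bounded_bilinear prod by fact
  obtain K where "K \<ge> 0" and K: "\<And>a b. norm (prod a b) \<le> norm a * norm b * K"
    using nonneg_bounded by blast
  have [measurable]: "f \<in> borel_measurable borel" "g \<in> borel_measurable borel"
    using assms(2,3) by auto
  have meas: "(\<lambda>(t, s). prod (f (t - s)) (g s)) \<in> borel_measurable (lborel \<Otimes>\<^sub>M lborel)"
    unfolding case_prod_beta by (rule borel_measurable_bilinear[OF assms(1)]) measurable
  have nnf: "(\<integral>\<^sup>+t. ennreal (norm (f (t - s))) \<partial>lborel) = (\<integral>\<^sup>+t. ennreal (norm (f t)) \<partial>lborel)" for s
    using nn_integral_real_affine[of "\<lambda>t. ennreal (norm (f t))" 1 "-s"] by simp
  have "(\<integral>\<^sup>+p. ennreal (norm (case p of (t, s) \<Rightarrow> prod (f (t - s)) (g s))) \<partial>(lborel \<Otimes>\<^sub>M lborel))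
      \<le> (\<integral>\<^sup>+p. (case p of (t, s) \<Rightarrow> ennreal (norm (f (t - s))) * ennreal (K * norm (g s))) \<partial>(lborel \<Otimes>\<^sub>M lborel))"
    using \<open>K \<ge> 0\<close>
    by (intro nn_integral_mono) (auto simp: ennreal_mult[symmetric] mult.commute mult.left_commute intro!: order_trans[OF K])
  also have "\<dots> = (\<integral>\<^sup>+s. \<integral>\<^sup>+t. ennreal (norm (f (t - s))) * ennreal (K * norm (g s)) \<partial>lborel \<partial>lborel)"
    by (subst lborel_pair.nn_integral_snd[symmetric]) auto
  also have "\<dots> = (\<integral>\<^sup>+s. (\<integral>\<^sup>+t. ennreal (norm (f t)) \<partial>lborel) * ennreal (K * norm (g s)) \<partial>lborel)"
    by (subst nn_integral_multc) (auto simp: nnf)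
  also have "\<dots> = (\<integral>\<^sup>+t. ennreal (norm (f t)) \<partial>lborel) * (\<integral>\<^sup>+s. ennreal (norm (K *\<^sub>R g s)) \<partial>lborel)"
    using \<open>K \<ge> 0\<close> by (subst nn_integral_cmult) auto
  also have "\<dots> < \<infinity>"
    using assms(2) integrable_scaleR_right[OF assms(3), of K]
    unfolding integrable_iff_bounded by (auto simp: ennreal_mult_less_top)
  finally show ?thesis
    using meas by (intro integrableI_bounded) auto
qed

lemma convolution_exists_AE:
  fixes prod :: "'a::{second_countable_topology, banach}
      \<Rightarrow> 'b::{second_countable_topology, banach} \<Rightarrow> 'c::{second_countable_topology, banach}"
  assumes "bounded_bilinear prod" "integrable lborel f" "integrable lborel g"
  shows "AE t::real in lborel. integrable lborel (\<lambda>s. prod (f (t - s)) (g s))"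
  using lborel_pair.AE_integrable_fst[OF integrable_pair_convolution[OF assms]] .

lemma integrable_convolution:
  fixes prod :: "'a::{second_countable_topology, banach}
      \<Rightarrow> 'b::{second_countable_topology, banach} \<Rightarrow> 'c::{second_countable_topology, banach}"
  assumes "bounded_bilinear prod" "integrable lborel f" "integrable lborel g"
  shows "integrable lborel (\<lambda>t::real. LBINT s. prod (f (t - s)) (g s))"
  using lborel_pair.integrable_fst[OF integrable_pair_convolution[OF assms]] .

text \<open>Fubini at a fixed t requires joint integrability in s and r. The integrand is dominated
  by a constant times that of |f| * (|g| * |v|), and this convolution of norms converges for almost
  every t; these are the t that are kept.\<close>

lemma convolution_assoc_AE:
  fixes f g :: "real \<Rightarrow> real^'n^'n" and v :: "real \<Rightarrow> real^'n"
  assumes f: "integrable lborel f" and g: "integrable lborel g" and v: "integrable lborel v"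
  shows "AE t in lborel. (LBINT s. f (t - s) *v (LBINT r. g (s - r) *v v r))
      = (LBINT r. (LBINT s. f (t - r - s) ** g s) *v v r)"
proof -
  interpret mv: bounded_bilinear "(*v) :: real^'n^'n \<Rightarrow> real^'n \<Rightarrow> real^'n"
    by (rule bounded_bilinear_matrix_vector_mult)
  obtain K where "K \<ge> 0" and K: "\<And>(a::real^'n^'n) (b::real^'n). norm (a *v b) \<le> norm a * norm b * K"
    using mv.nonneg_bounded by blast
  have [measurable]: "f \<in> borel_measurable borel" "g \<in> borel_measurable borel" "v \<in> borel_measurable borel"
    using assms by auto
  note meas_mv[measurable (raw)] = borel_measurable_bilinear[OF bounded_bilinear_matrix_vector_mult]
  note meas_mm[measurable (raw)] = borel_measurable_bilinear[OF bounded_bilinear_matrix_matrix_mult]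
  define k where "k s = (LBINT r. norm (g (s - r)) * norm (v r))" for s
  have mult: "bounded_bilinear ((*) :: real \<Rightarrow> real \<Rightarrow> real)"
    by (rule bounded_bilinear_mult)
  have k: "integrable lborel k"
    unfolding k_def by (intro integrable_convolution[OF mult] integrable_norm g v)
  have [measurable]: "k \<in> borel_measurable borel"
    using k by auto
  have gv: "AE s in lborel. integrable lborel (\<lambda>r. norm (g (s - r)) * norm (v r))"
    by (intro convolution_exists_AE[OF mult] integrable_norm g v)
  have fk: "AE t in lborel. integrable lborel (\<lambda>s. norm (f (t - s)) * k s)"
    by (intro convolution_exists_AE[OF mult] integrable_norm f k)
  have fg: "AE x in lborel. integrable lborel (\<lambda>s. f (x - s) ** g s)"
    by (intro convolution_exists_AE[OF bounded_bilinear_matrix_matrix_mult] f g)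
  show ?thesis
    using fk
  proof eventually_elim
    case (elim t)
    let ?h = "\<lambda>s r. f (t - s) *v (g (s - r) *v v r)"
    have bound: "norm (?h s r) \<le> K * K * norm (f (t - s)) * (norm (g (s - r)) * norm (v r))" for s r
    proof -
      have "norm (?h s r) \<le> norm (f (t - s)) * norm (g (s - r) *v v r) * K"
        by (rule K)
      also have "\<dots> \<le> norm (f (t - s)) * (norm (g (s - r)) * norm (v r) * K) * K"
        using \<open>K \<ge> 0\<close> by (intro mult_right_mono mult_left_mono K) auto
      finally show ?thesis
        by (simp add: ac_simps)
    qed
    have gv_int: "AE s in lborel. integrable lborel (\<lambda>r. g (s - r) *v v r)"
      using gv
    proof eventually_elim
      case (elim s)
      then have "integrable lborel (\<lambda>r. K * (norm (g (s - r)) * norm (v r)))"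
        by (rule integrable_mult_right)
      then show ?case
        by (rule Bochner_Integration.integrable_bound)
          (use K \<open>K \<ge> 0\<close> in \<open>auto simp: abs_mult ac_simps\<close>)
    qed
    have h_int: "AE s in lborel. integrable lborel (?h s)"
      using gv_int by eventually_elim (rule integrable_bounded_linear[OF mv.bounded_linear_right])
    have h_pair: "integrable (lborel \<Otimes>\<^sub>M lborel) (\<lambda>(s, r). ?h s r)"
    proof (rule lborel_pair.Fubini_integrable)
      show "integrable lborel (\<lambda>s. LBINT r. norm (case (s, r) of (s, r) \<Rightarrow> ?h s r))"
      proof (rule Bochner_Integration.integrable_bound)
        show "integrable lborel (\<lambda>s. K * K * (norm (f (t - s)) * k s))"
          using elim by (rule integrable_mult_right)
        show "AE s in lborel. norm (LBINT r. norm (case (s, r) of (s, r) \<Rightarrow> ?h s r))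
            \<le> norm (K * K * (norm (f (t - s)) * k s))"
          using gv h_int
        proof eventually_elim
          case (elim s)
          have "(LBINT r. norm (?h s r)) \<le> (LBINT r. K * K * norm (f (t - s)) * (norm (g (s - r)) * norm (v r)))"
            using elim bound by (intro integral_mono integrable_norm integrable_mult_right) auto
          also have "\<dots> = K * K * (norm (f (t - s)) * k s)"
            by (simp add: k_def)
          finally show ?case
            by (simp add: abs_of_nonneg)
        qed
      qed measurable
      show "AE s in lborel. integrable lborel (\<lambda>r. case (s, r) of (s, r) \<Rightarrow> ?h s r)"
        using h_int by simp
    qed measurable
    have "(LBINT s. f (t - s) *v (LBINT r. g (s - r) *v v r)) = (LBINT s. LBINT r. ?h s r)"
    proof (rule integral_cong_AE)
      show "AE s in lborel. f (t - s) *v (LBINT r. g (s - r) *v v r) = (LBINT r. ?h s r)"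
        using gv_int
        by eventually_elim (rule integral_bounded_linear[OF mv.bounded_linear_right, symmetric])
    qed measurable
    also have "\<dots> = (LBINT r. LBINT s. ?h s r)"
      by (rule lborel_pair.Fubini_integral[OF h_pair, symmetric])
    also have "\<dots> = (LBINT r. (LBINT s. f (t - r - s) ** g s) *v v r)"
    proof (rule integral_cong_AE)
      \<comment> \<open>The matrix convolution is needed at \<open>t - r\<close>, so its exceptional
        null set is pulled back along the map from r to \<open>t - r\<close>.\<close>
      have "AE r in lborel. integrable lborel (\<lambda>s. f (t + (-1) * r - s) ** g s)"
        by (rule AE_lborel_affine[OF fg]) simp
      then show "AE r in lborel. (LBINT s. ?h s r) = (LBINT s. f (t - r - s) ** g s) *v v r"
      proof eventually_elim
        case (elim r)
        have "(LBINT s. ?h s r) = (LBINT s. ?h (r + 1 * s) r)"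
          by (subst lborel_integral_real_affine[of 1 _ r]) auto
        also have "\<dots> = (LBINT s. (f (t - r - s) ** g s) *v v r)"
          by (simp add: matrix_vector_mul_assoc algebra_simps)
        also have "\<dots> = (LBINT s. f (t - r - s) ** g s) *v v r"
          using elim by (intro integral_bounded_linear[OF mv.bounded_linear_left]) simp
        finally show ?case .
      qed
    qed measurable
    finally show ?case .
  qed
qed

section \<open>From the interval [0,t] to the whole line\<close>

text \<open>The convolutions of the statement are Lebesgue integrals over \<open>[0,t]\<close> of functions that are only
  Lebesgue measurable. Below the horizon \<open>T\<close> they agree with convolutions on the whole line of
  integrable Borel functions vanishing on \<open>]-\<infinity>,0]\<close>, to which Fubini's theorem applies.\<close>

definition borel_version :: "real \<Rightarrow> (real \<Rightarrow> 'a::{banach, second_countable_topology}) \<Rightarrow> (real \<Rightarrow> 'a) \<Rightarrow> bool" where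
  "borel_version T f f' \<longleftrightarrow> integrable lborel f' \<and> (\<forall>s\<le>0. f' s = 0) \<and>
     (AE s in lborel. 0 < s \<and> s < T \<longrightarrow> f' s = f s)"

lemma lebesgue_measurable_AE_borel:
  fixes f :: "real \<Rightarrow> 'a::euclidean_space"
  assumes "f \<in> borel_measurable lebesgue"
  obtains f' where "f' \<in> borel_measurable borel" "AE x in lborel. f x = f' x"
proof -
  have "\<forall>b\<in>Basis. \<exists>g. g \<in> borel_measurable lborel \<and> (AE x in lborel. f x \<bullet> b = g x)"
  proof
    fix b :: 'a
    have "(\<lambda>x. f x \<bullet> b) \<in> borel_measurable lebesgue"
      using assms by measurable
    then show "\<exists>g. g \<in> borel_measurable lborel \<and> (AE x in lborel. f x \<bullet> b = g x)"
      using completion_ex_borel_measurable_real by blast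
  qed
  then obtain g where g: "\<And>b. b \<in> Basis \<Longrightarrow> g b \<in> borel_measurable lborel"
    "\<And>b. b \<in> Basis \<Longrightarrow> AE x in lborel. f x \<bullet> b = g b x"
    by metis
  show ?thesis
  proof
    show "(\<lambda>x. \<Sum>b\<in>Basis. g b x *\<^sub>R b) \<in> borel_measurable borel"
      using g(1) by (intro borel_measurable_sum borel_measurable_scaleR) auto
    have "AE x in lborel. \<forall>b\<in>Basis. f x \<bullet> b = g b x"
      using g(2) by (intro AE_finite_allI) auto
    then show "AE x in lborel. f x = (\<Sum>b\<in>Basis. g b x *\<^sub>R b)"
    proof eventually_elim
      case (elim x)
      have "f x = (\<Sum>b\<in>Basis. (f x \<bullet> b) *\<^sub>R b)"
        by (rule euclidean_representation[symmetric])
      also have "\<dots> = (\<Sum>b\<in>Basis. g b x *\<^sub>R b)"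
        using elim by (intro sum.cong) auto
      finally show ?case .
    qed
  qed
qed

lemma borel_version_exists:
  fixes f :: "real \<Rightarrow> 'a::euclidean_space"
  assumes f: "f absolutely_integrable_on {0..T}"
  obtains f' where "borel_version T f f'"
proof -
  \<comment> \<open>The open interval discards the value at 0, where a Borel version has to
    vanish.\<close>
  let ?f = "\<lambda>s. indicat_real {0<..<T} s *\<^sub>R f s"
  have f_int: "integrable lebesgue ?f"
    using set_integrable_subset[OF f, of "{0<..<T}"]
    by (simp add: set_integrable_def greaterThanLessThan_subseteq_atLeastAtMost_iff)
  obtain g where [measurable]: "g \<in> borel_measurable borel" and g: "AE s in lborel. ?f s = g s"
    using lebesgue_measurable_AE_borel[OF borel_measurable_integrable[OF f_int]] by blast
  \<comment> \<open>\<open>g\<close> vanishes outside the interval only almost everywhere; the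
    second cut-off makes it vanish at every point of ]-\<infinity>,0].\<close>
  define f' where "f' s = indicat_real {0<..<T} s *\<^sub>R g s" for s
  have [measurable]: "f' \<in> borel_measurable borel"
    unfolding f'_def by measurable
  have eq: "AE s in lborel. ?f s = f' s"
    using g by eventually_elim (auto simp: f'_def indicator_def split: if_splits)
  have "integrable lebesgue f'"
  proof (rule integrable_cong_AE_imp[OF f_int])
    show "f' \<in> borel_measurable lebesgue"
      by (intro measurable_completion) auto
    show "AE s in lebesgue. ?f s = f' s"
      using eq by (rule AE_completion)
  qed
  then have "integrable lborel f'"
    by (simp add: integrable_completion)
  moreover have "AE s in lborel. 0 < s \<and> s < T \<longrightarrow> f' s = f s"
    using eq by eventually_elim (auto simp: indicator_def split: if_splits)
  ultimately have "borel_version T f f'"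
    by (auto simp: borel_version_def f'_def)
  then show ?thesis
    by (rule that)
qed

text \<open>This direction turns integrability of a convolution on the line into local integrability
  of \<open>conv_mv\<close>.\<close>

lemma borel_version_imp_absolutely_integrable:
  fixes f :: "real \<Rightarrow> 'a::euclidean_space"
  assumes "borel_version T f f'"
  shows "f absolutely_integrable_on {0..T}"
proof -
  have "integrable lebesgue f'"
    using assms by (auto simp: borel_version_def integrable_completion)
  then have f': "f' absolutely_integrable_on {0..T}"
    by (simp add: set_integrable_def integrable_mult_indicator)
  have "AE s in lebesgue. 0 < s \<and> s < T \<longrightarrow> f' s = f s"
    using assms by (intro AE_completion) (simp add: borel_version_def)
  then obtain N where "negligible N" and N: "{s. \<not> (0 < s \<and> s < T \<longrightarrow> f' s = f s)} \<subseteq> N"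
    unfolding eventually_ae_filter_negligible by blast
  have neg: "negligible (N \<union> {0, T})"
    using \<open>negligible N\<close> by (simp add: negligible_Un)
  show ?thesis
  proof (rule absolutely_integrable_spike[OF f' neg])
    fix s assume "s \<in> {0..T} - (N \<union> {0, T})"
    then have "0 < s" "s < T" "s \<notin> N" by auto
    then show "f s = f' s"
      using N by (metis (mono_tags, lifting) mem_Collect_eq subsetD)
  qed
qed

text \<open>Lebesgue measure is complete, so either both functions are measurable or neither is, and
  in the latter case both integrals are 0 by convention.\<close>

lemma integral_lebesgue_cong_AE:
  fixes f g :: "real \<Rightarrow> 'a::euclidean_space"
  assumes "AE x in lebesgue. f x = g x"
  shows "integral\<^sup>L lebesgue f = integral\<^sup>L lebesgue g"
proof (cases "f \<in> borel_measurable lebesgue")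
  case True
  then have "g \<in> borel_measurable lebesgue"
    using assms by (rule borel_measurable_AE)
  with True assms show ?thesis
    by (intro integral_cong_AE)
next
  case False
  moreover have "g \<notin> borel_measurable lebesgue"
  proof
    assume "g \<in> borel_measurable lebesgue"
    then have "f \<in> borel_measurable lebesgue"
      by (rule borel_measurable_AE) (use assms in eventually_elim, simp)
    with False show False by simp
  qed
  ultimately show ?thesis
    by (metis borel_measurable_integrable not_integrable_integral_eq)
qed

text \<open>Vanishing of \<open>f'\<close> and \<open>g'\<close> on ]-\<infinity>,0] takes the place
  of the restriction to [0,t]. The equality holds at every t of the interval: where the integrals
  diverge, both sides have the default value 0.\<close>

lemma convolution_borel_version_eq:
  fixes prod :: "'a::euclidean_space \<Rightarrow> 'b::euclidean_space \<Rightarrow> 'c::euclidean_space"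
  assumes prod: "bounded_bilinear prod" and f: "borel_version T f f'" and g: "borel_version T g g'"
    and t: "0 < t" "t < T"
  shows "(LINT s:{0..t}|lebesgue. prod (f (t - s)) (g s)) = (LBINT s. prod (f' (t - s)) (g' s))"
proof -
  interpret bounded_bilinear prod by fact
  have [measurable]: "f' \<in> borel_measurable borel" "g' \<in> borel_measurable borel"
    using f g by (auto simp: borel_version_def)
  have "AE s in lborel. 0 < t + (-1) * s \<and> t + (-1) * s < T \<longrightarrow> f' (t + (-1) * s) = f (t + (-1) * s)"
    using f by (intro AE_lborel_affine) (auto simp: borel_version_def)
  moreover have "AE s in lborel. 0 < s \<and> s < T \<longrightarrow> g' s = g s"
    using g by (simp add: borel_version_def)
  moreover have "AE s in lborel. s \<noteq> 0" "AE s in lborel. s \<noteq> t"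
    by (rule AE_lborel_singleton)+
  ultimately have "AE s in lborel. indicat_real {0..t} s *\<^sub>R prod (f (t - s)) (g s) = prod (f' (t - s)) (g' s)"
  proof eventually_elim
    case (elim s)
    consider "s < 0" | "s > t" | "0 < s" "s < t"
      using elim by linarith
    then show ?case
    proof cases
      case 1
      then have "g' s = 0" using g by (simp add: borel_version_def)
      then show ?thesis using 1 by (simp add: zero_right)
    next
      case 2
      then have "f' (t - s) = 0" using f by (simp add: borel_version_def)
      then show ?thesis using 2 by (simp add: zero_left)
    next
      case 3
      then show ?thesis using elim t by simp
    qed
  qed
  then have "AE s in lebesgue. indicat_real {0..t} s *\<^sub>R prod (f (t - s)) (g s) = prod (f' (t - s)) (g' s)"
    by (rule AE_completion)
  then have "(LINT s:{0..t}|lebesgue. prod (f (t - s)) (g s)) = (LINT s|lebesgue. prod (f' (t - s)) (g' s))"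
    unfolding set_lebesgue_integral_def by (rule integral_lebesgue_cong_AE)
  also have "\<dots> = (LBINT s. prod (f' (t - s)) (g' s))"
    by (intro integral_completion) (simp add: borel_measurable_bilinear[OF prod])
  finally show ?thesis .
qed

lemma borel_version_convolution:
  fixes prod :: "'a::euclidean_space \<Rightarrow> 'b::euclidean_space \<Rightarrow> 'c::euclidean_space"
  assumes prod: "bounded_bilinear prod" and f: "borel_version T f f'" and g: "borel_version T g g'"
  shows "borel_version T (\<lambda>t. LINT s:{0..t}|lebesgue. prod (f (t - s)) (g s))
    (\<lambda>t. LBINT s. prod (f' (t - s)) (g' s))"
  unfolding borel_version_def
proof (intro conjI allI impI)
  interpret bounded_bilinear prod by fact
  show "integrable lborel (\<lambda>t. LBINT s. prod (f' (t - s)) (g' s))"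
    using f g by (intro integrable_convolution[OF prod]) (auto simp: borel_version_def)
  show "(LBINT s. prod (f' (t - s)) (g' s)) = 0" if "t \<le> 0" for t
  proof -
    have "prod (f' (t - s)) (g' s) = 0" for s
      using f g that by (cases "s \<le> 0") (auto simp: borel_version_def zero_left zero_right)
    then show ?thesis by simp
  qed
  show "AE t in lborel. 0 < t \<and> t < T \<longrightarrow>
      (LBINT s. prod (f' (t - s)) (g' s)) = (LINT s:{0..t}|lebesgue. prod (f (t - s)) (g s))"
    using convolution_borel_version_eq[OF assms] by auto
qed

lemma borel_version_conv_mv:
  assumes "borel_version T F f" "borel_version T v g"
  shows "borel_version T (conv_mv F v) (\<lambda>t. LBINT s. f (t - s) *v g s)"
  unfolding conv_mv_def[abs_def]
  by (rule borel_version_convolution[OF bounded_bilinear_matrix_vector_mult assms])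

lemma borel_version_conv_mm:
  assumes "borel_version T F f" "borel_version T G g"
  shows "borel_version T (conv_mm F G) (\<lambda>t. LBINT s. f (t - s) ** g s)"
  unfolding conv_mm_def[abs_def]
  by (rule borel_version_convolution[OF bounded_bilinear_matrix_matrix_mult assms])

text \<open>Borel versions depend on the horizon. Countably many horizons suffice, so it is the null
  sets that are united and not the versions.\<close>

lemma AE_pos_if_AE_bounded:
  assumes "\<And>T. T > 0 \<Longrightarrow> AE t in lborel. 0 < t \<and> t < T \<longrightarrow> P (t::real)"
  shows "AE t in lebesgue. t > 0 \<longrightarrow> P t"
proof -
  have "AE t in lborel. \<forall>n. 0 < t \<and> t < real (Suc n) \<longrightarrow> P t"
    unfolding AE_all_countable using assms by simp
  then have "AE t in lborel. t > 0 \<longrightarrow> P t"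
  proof eventually_elim
    case (elim t)
    obtain n where "t < real n"
      using reals_Archimedean2 by blast
    then show ?case
      using elim[rule_format, of n] by auto
  qed
  then show ?thesis
    by (rule AE_completion)
qed

section \<open>Calculus of locally integrable convolutions\<close>

definition locally_integrable_matrix :: "(real \<Rightarrow> real^'n^'n) \<Rightarrow> bool" where
  "locally_integrable_matrix F \<longleftrightarrow> (\<forall>T>0. F absolutely_integrable_on {0..T})"

lemma conv_mv_locally_integrable:
  assumes "locally_integrable_matrix F" "locally_integrable v"
  shows "locally_integrable (conv_mv F v)"
  unfolding locally_integrable_def
proof (intro allI impI)
  fix T :: real assume "T > 0"
  with assms obtain f' v' where "borel_version T F f'" "borel_version T v v'"
    unfolding locally_integrable_def locally_integrable_matrix_def by (metis borel_version_exists)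
  from borel_version_conv_mv[OF this] show "conv_mv F v absolutely_integrable_on {0..T}"
    by (rule borel_version_imp_absolutely_integrable)
qed

lemma conv_mv_assoc:
  assumes "locally_integrable_matrix F" "locally_integrable_matrix G" "locally_integrable v"
  shows "AE t in lebesgue. t > 0 \<longrightarrow> conv_mv F (conv_mv G v) t = conv_mv (conv_mm F G) v t"
proof (rule AE_pos_if_AE_bounded)
  fix T :: real assume "T > 0"
  with assms obtain f' g' v' where f: "borel_version T F f'" and g: "borel_version T G g'"
    and v: "borel_version T v v'"
    unfolding locally_integrable_def locally_integrable_matrix_def by (metis borel_version_exists)
  have "AE t in lborel. (LBINT s. f' (t - s) *v (LBINT r. g' (s - r) *v v' r))
      = (LBINT r. (LBINT s. f' (t - r - s) ** g' s) *v v' r)"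
    using f g v by (intro convolution_assoc_AE) (auto simp: borel_version_def)
  moreover have "AE t in lborel. 0 < t \<and> t < T \<longrightarrow>
      (LBINT s. f' (t - s) *v (LBINT r. g' (s - r) *v v' r)) = conv_mv F (conv_mv G v) t"
    using borel_version_conv_mv[OF f borel_version_conv_mv[OF g v]] by (simp add: borel_version_def)
  moreover have "AE t in lborel. 0 < t \<and> t < T \<longrightarrow>
      (LBINT r. (LBINT s. f' (t - r - s) ** g' s) *v v' r) = conv_mv (conv_mm F G) v t"
    using borel_version_conv_mv[OF borel_version_conv_mm[OF f g] v] by (simp add: borel_version_def)
  ultimately show "AE t in lborel. 0 < t \<and> t < T \<longrightarrow> conv_mv F (conv_mv G v) t = conv_mv (conv_mm F G) v t"
    by eventually_elim auto
qed

text \<open>Additivity is claimed almost everywhere, because at a given t the integral of the sum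
  may converge while those of the summands diverge.\<close>

lemma conv_mv_add:
  assumes F: "locally_integrable_matrix F" and u: "locally_integrable u" and v: "locally_integrable v"
  shows "AE t in lebesgue. t > 0 \<longrightarrow> conv_mv F (\<lambda>s. u s + v s) t = conv_mv F u t + conv_mv F v t"
proof (rule AE_pos_if_AE_bounded)
  fix T :: real assume "T > 0"
  with assms obtain f' u' v' where f: "borel_version T F f'" and u: "borel_version T u u'"
    and v: "borel_version T v v'"
    unfolding locally_integrable_def locally_integrable_matrix_def by (metis borel_version_exists)
  have uv: "borel_version T (\<lambda>s. u s + v s) (\<lambda>s. u' s + v' s)"
    using u v by (auto simp: borel_version_def)
  have "AE t in lborel. integrable lborel (\<lambda>s. f' (t - s) *v u' s)"
    "AE t in lborel. integrable lborel (\<lambda>s. f' (t - s) *v v' s)"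
    using f u v by (intro convolution_exists_AE[OF bounded_bilinear_matrix_vector_mult]; simp add: borel_version_def)+
  moreover have
    "AE t in lborel. 0 < t \<and> t < T \<longrightarrow> (LBINT s. f' (t - s) *v u' s) = conv_mv F u t"
    "AE t in lborel. 0 < t \<and> t < T \<longrightarrow> (LBINT s. f' (t - s) *v v' s) = conv_mv F v t"
    "AE t in lborel. 0 < t \<and> t < T \<longrightarrow> (LBINT s. f' (t - s) *v (u' s + v' s)) = conv_mv F (\<lambda>s. u s + v s) t"
    using borel_version_conv_mv[OF f u] borel_version_conv_mv[OF f v] borel_version_conv_mv[OF f uv]
    by (simp_all add: borel_version_def)
  ultimately show "AE t in lborel. 0 < t \<and> t < T \<longrightarrow> conv_mv F (\<lambda>s. u s + v s) t = conv_mv F u t + conv_mv F v t"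
    by eventually_elim (auto simp: matrix_vector_right_distrib)
qed

lemma conv_mv_cong:
  assumes "AE s in lebesgue. s > 0 \<longrightarrow> u s = v s"
  shows "conv_mv F u t = conv_mv F v t"
  unfolding conv_mv_def set_lebesgue_integral_def
proof (rule integral_lebesgue_cong_AE)
  have "AE s in lebesgue. s \<noteq> (0::real)"
    by (intro AE_completion AE_lborel_singleton)
  with assms show "AE s in lebesgue. indicat_real {0..t} s *\<^sub>R (F (t - s) *v u s)
      = indicat_real {0..t} s *\<^sub>R (F (t - s) *v v s)"
    by eventually_elim (auto simp: indicator_def)
qed

text \<open>For s in [0,t] the kernel is evaluated at 0 only when s = t, a null set. This admits the
  Sonine equation, which holds for positive arguments.\<close>

lemma conv_mv_cong_kernel:
  assumes "\<And>s. s > 0 \<Longrightarrow> F s = G s"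
  shows "conv_mv F v t = conv_mv G v t"
  unfolding conv_mv_def set_lebesgue_integral_def
proof (rule integral_lebesgue_cong_AE)
  have "AE s in lebesgue. s \<noteq> t"
    by (intro AE_completion AE_lborel_singleton)
  then show "AE s in lebesgue. indicat_real {0..t} s *\<^sub>R (F (t - s) *v v s)
      = indicat_real {0..t} s *\<^sub>R (G (t - s) *v v s)"
    by eventually_elim (use assms in \<open>auto simp: indicator_def\<close>)
qed

lemma conv_mv_identity:
  assumes "locally_integrable v" "t > 0"
  shows "conv_mv (\<lambda>_. mat 1) v t = integral {0..t} v"
  using assms by (simp add: conv_mv_def locally_integrable_def set_lebesgue_integral_eq_integral(2))

lemma set_integral_reflect:
  fixes f :: "real \<Rightarrow> 'a::euclidean_space"
  shows "(LINT s:{0..t}|lebesgue. f (t - s)) = (LINT s:{0..t}|lebesgue. f s)"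
proof -
  have "(LINT s:{0..t}|lebesgue. f s) = (LINT s|lebesgue. indicat_real {0..t} (t + (-1) * s) *\<^sub>R f (t + (-1) * s))"
    unfolding set_lebesgue_integral_def by (subst lebesgue_integral_real_affine[of "-1" _ t]) auto
  also have "(\<lambda>s. indicat_real {0..t} (t + (-1) * s) *\<^sub>R f (t + (-1) * s)) = (\<lambda>s. indicat_real {0..t} s *\<^sub>R f (t - s))"
    by (auto simp: indicator_def fun_eq_iff)
  finally show ?thesis
    by (simp add: set_lebesgue_integral_def)
qed

lemma conv_mm_identity_commute: "conv_mm (\<lambda>_. mat 1) F t = conv_mm F (\<lambda>_. mat 1) t"
  unfolding conv_mm_def using set_integral_reflect[of t F] by simp

lemma locally_integrable_matrix_const: "locally_integrable_matrix (\<lambda>_. A)"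
  by (auto simp: locally_integrable_matrix_def intro!: absolutely_integrable_continuous_real continuous_intros)

lemma locally_integrable_const: "locally_integrable (\<lambda>_. c)"
  by (auto simp: locally_integrable_def intro!: absolutely_integrable_continuous_real continuous_intros)

lemma locally_integrable_indefinite_integral:
  assumes "locally_integrable f"
  shows "locally_integrable (\<lambda>t. integral {0..t} f)"
  unfolding locally_integrable_def
proof (intro allI impI absolutely_integrable_continuous_real)
  fix T :: real assume "T > 0"
  then show "continuous_on {0..T} (\<lambda>t. integral {0..t} f)"
    using assms
    by (intro indefinite_integral_continuous_1 set_lebesgue_integral_eq_integral(1)) (simp add: locally_integrable_def)
qed

text \<open>Integration is convolution with the constant kernel \<open>mat 1\<close>, which commutes
  with \<open>F\<close> by the reflection of s into \<open>t - s\<close>. Two instances of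
  associativity then move it from the right factor to the outside.\<close>

lemma integral_conv_mv:
  assumes F: "locally_integrable_matrix F" and f: "locally_integrable f"
  shows "AE t in lebesgue. t > 0 \<longrightarrow> conv_mv F (\<lambda>s. integral {0..s} f) t = integral {0..t} (conv_mv F f)"
proof -
  let ?I = "\<lambda>_::real. mat 1 :: real^'n^'n"
  have I: "locally_integrable_matrix ?I"
    by (rule locally_integrable_matrix_const)
  have eq: "conv_mv F (\<lambda>s. integral {0..s} f) t = conv_mv F (conv_mv ?I f) t" for t
    by (rule conv_mv_cong) (simp add: conv_mv_identity[OF f])
  have comm: "conv_mm ?I F = conv_mm F ?I"
    using conv_mm_identity_commute by blast
  show ?thesis
    using conv_mv_assoc[OF I F f] conv_mv_assoc[OF F I f]
  proof eventually_elim
    case (elim t)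
    then show ?case
      using conv_mv_identity[OF conv_mv_locally_integrable[OF F f], of t] by (simp add: eq comm)
  qed
qed

lemma locally_integrable_matrix_vector_mult:
  assumes "locally_integrable_matrix F"
  shows "locally_integrable (\<lambda>s. F s *v c)"
proof -
  have "bounded_linear (\<lambda>A. A *v c)"
    by (rule bounded_bilinear.bounded_linear_left[OF bounded_bilinear_matrix_vector_mult])
  from absolutely_integrable_linear[OF _ this] show ?thesis
    using assms by (auto simp: locally_integrable_def locally_integrable_matrix_def o_def)
qed

lemma conv_mv_const:
  assumes "locally_integrable_matrix F" and "t > 0"
  shows "conv_mv F (\<lambda>_. c) t = integral {0..t} (\<lambda>s. F s *v c)"
proof -
  have "conv_mv F (\<lambda>_. c) t = (LINT s:{0..t}|lebesgue. F s *v c)"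
    unfolding conv_mv_def using set_integral_reflect[of t "\<lambda>s. F s *v c"] by simp
  also have "\<dots> = integral {0..t} (\<lambda>s. F s *v c)"
    using locally_integrable_matrix_vector_mult[OF assms(1)] \<open>t > 0\<close>
    by (intro set_lebesgue_integral_eq_integral(2)) (simp add: locally_integrable_def)
  finally show ?thesis .
qed

lemma conv_mm_transpose:
  assumes "\<And>s. s > 0 \<Longrightarrow> transpose (F s) = F s" "\<And>s. s > 0 \<Longrightarrow> transpose (G s) = G s"
  shows "conv_mm G F t = transpose (conv_mm F G t)"
proof -
  have lin: "bounded_linear (transpose :: real^'n^'n \<Rightarrow> real^'n^'n)"
    by (auto intro!: linear_conv_bounded_linear[THEN iffD1] linearI simp: transpose_def vec_eq_iff)
  have "conv_mm G F t = (LINT s:{0..t}|lebesgue. G s ** F (t - s))"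
    unfolding conv_mm_def using set_integral_reflect[of t "\<lambda>s. G s ** F (t - s)"] by simp
  also have "\<dots> = (LINT s|lebesgue. transpose (indicat_real {0..t} s *\<^sub>R (F (t - s) ** G s)))"
    unfolding set_lebesgue_integral_def
  proof (rule integral_lebesgue_cong_AE)
    have "AE s in lebesgue. s \<noteq> (0::real)" "AE s in lebesgue. s \<noteq> t"
      by (intro AE_completion AE_lborel_singleton)+
    then show "AE s in lebesgue. indicat_real {0..t} s *\<^sub>R (G s ** F (t - s))
        = transpose (indicat_real {0..t} s *\<^sub>R (F (t - s) ** G s))"
      by eventually_elim
        (auto simp: indicator_def matrix_transpose_mul assms linear_simps[OF lin])
  qed
  also have "\<dots> = transpose (conv_mm F G t)"
    unfolding conv_mm_def set_lebesgue_integral_def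
    \<comment> \<open>Transposition is its own inverse, so it passes through the integral also at
      those t where the integrand is not integrable.\<close>
    by (rule integral_bounded_linear'[OF lin lin]) simp
  finally show ?thesis .
qed

section \<open>LICM kernels and the two operator identities\<close>

lemma LICM_locally_integrable:
  assumes "LICM F"
  shows "locally_integrable_matrix F"
  unfolding locally_integrable_matrix_def
proof (intro allI impI)
  fix T :: real assume "T > 0"
  \<comment> \<open>Away from 0 the entries are differentiable, hence continuous, by the clause for
    \<open>n = 0\<close>; near 0 integrability is part of \<open>LICM\<close>.\<close>
  have "continuous_on {1..T} (\<lambda>s. F s $ i $ j)" for i j
  proof (rule continuous_at_imp_continuous_on, rule ballI)
    fix s assume "s \<in> {1..T}"
    have "\<forall>n i j. \<forall>t>0. (deriv ^^ n) (\<lambda>s. F s $ i $ j) differentiable (at t)"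
      using assms unfolding LICM_def completely_monotone_def by (elim conjE)
    from this[rule_format, of s 0 i j] have "(\<lambda>s. F s $ i $ j) differentiable (at s)"
      using \<open>s \<in> {1..T}\<close> by simp
    then show "isCont (\<lambda>s. F s $ i $ j) s"
      by (rule differentiable_imp_continuous_within)
  qed
  then have "continuous_on {1..T} (\<lambda>s. \<chi> i j. F s $ i $ j)"
    by (intro continuous_on_vec_lambda)
  then have "F absolutely_integrable_on {1..T}"
    by (intro absolutely_integrable_continuous_real) simp
  moreover have "F absolutely_integrable_on {0<..1}"
    using assms by (simp add: LICM_def)
  ultimately have "F absolutely_integrable_on {0<..1} \<union> {1..T}"
    by (intro set_integrable_Un) auto
  then have "F absolutely_integrable_on {0<..T}"
    by (rule set_integrable_subset) auto
  then show "F absolutely_integrable_on {0..T}"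
    by (rule absolutely_integrable_spike_set) (rule negligible_subset[of "{0}"]; force)+
qed

text \<open>Stated for any pair of kernels, so that it serves both for F * G and, with the roles
  exchanged, for G * F.\<close>

lemma AE_integral_eq_conv_mv:
  assumes F: "locally_integrable_matrix F" and G: "locally_integrable_matrix G" and v: "locally_integrable v"
    and sonine: "\<And>t. t > 0 \<Longrightarrow> conv_mm F G t = mat 1"
  shows "AE t in lebesgue. t > 0 \<longrightarrow> conv_mv F (conv_mv G v) t = integral {0..t} v"
  using conv_mv_assoc[OF F G v]
proof eventually_elim
  case (elim t)
  have "conv_mv (conv_mm F G) v t = conv_mv (\<lambda>_. mat 1) v t"
    by (rule conv_mv_cong_kernel) (rule sonine)
  then show ?case
    using elim conv_mv_identity[OF v] by simp
qed

lemma D_F_AC: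
  assumes F: "locally_integrable_matrix F" and f: "locally_integrable f"
    and w: "\<And>t. t \<ge> 0 \<Longrightarrow> w t = w 0 + integral {0..t} f"
  shows "AE t in lebesgue. t > 0 \<longrightarrow> D_F F w t = conv_mv F f t"
proof -
  let ?k = "\<lambda>t. F t *v w 0 + conv_mv F f t"
  note Ff = conv_mv_locally_integrable[OF F f]
  note Fw0 = locally_integrable_matrix_vector_mult[OF F, of "w 0"]
  have k: "locally_integrable ?k"
    using Ff Fw0 by (auto simp: locally_integrable_def intro!: set_integral_add(1))
  have k_int: "integral {0..t} ?k = integral {0..t} (\<lambda>t. F t *v w 0) + integral {0..t} (conv_mv F f)" if "t > 0" for t
    using Ff Fw0 that
    by (intro Henstock_Kurzweil_Integration.integral_add set_lebesgue_integral_eq_integral(1))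
      (auto simp: locally_integrable_def)
  \<comment> \<open>The integral representation of \<open>w\<close> is available on [0,\<infinity>[
    only, which is all that the convolution sees.\<close>
  have eq: "conv_mv F w t = conv_mv F (\<lambda>s. w 0 + integral {0..s} f) t" for t
    by (rule conv_mv_cong) (intro AE_I2 impI w less_imp_le)
  have "AE t in lebesgue. t > 0 \<longrightarrow> conv_mv F w t = integral {0..t} ?k"
    using conv_mv_add[OF F locally_integrable_const locally_integrable_indefinite_integral[OF f], of "w 0"]
      integral_conv_mv[OF F f]
  proof eventually_elim
    case (elim t)
    show ?case
    proof
      assume "t > 0"
      then show "conv_mv F w t = integral {0..t} ?k"
        using elim by (simp only: eq k_int conv_mv_const[OF F])
    qed
  qed
  from D_op_indefinite_integral[OF k this] show ?thesis
    by eventually_elim (simp add: D_F_def)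
qed

text \<open>This removes the initial value term \<open>F t *v v 0\<close> of \<open>D_F\<close> when
  it is applied to \<open>J_op G v\<close>.\<close>

lemma conv_mv_0: "conv_mv F v 0 = 0"
proof -
  have "AE s in lebesgue. s \<noteq> (0::real)"
    by (intro AE_completion AE_lborel_singleton)
  then have "AE s in lebesgue. indicat_real {0..0} s *\<^sub>R (F (0 - s) *v v s) = 0"
    by eventually_elim (simp add: indicator_def)
  from integral_lebesgue_cong_AE[OF this] show ?thesis
    by (simp add: conv_mv_def set_lebesgue_integral_def)
qed

theorem theorem4p1:
  fixes F G :: "real \<Rightarrow> real^'n^'n"
  assumes "singular_LICM F"
    and "sonine_solution F G"
  shows "(\<forall>w. AC w \<longrightarrow>
            (AE t in lebesgue_on {0..}. J_op G (D_F F w) t = w t - w 0)) \<and>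
         (\<forall>v. locally_integrable v \<longrightarrow>
            (AE t in lebesgue_on {0..}. D_F F (J_op G v) t = v t))"
proof (intro conjI allI impI)
  have LICM: "LICM F" "LICM G" and FG: "\<And>t. t > 0 \<Longrightarrow> conv_mm F G t = mat 1"
    using assms by (auto simp: singular_LICM_def sonine_solution_def)
  have F: "locally_integrable_matrix F" and G: "locally_integrable_matrix G"
    using LICM by (auto intro: LICM_locally_integrable)
  have GF: "conv_mm G F t = mat 1" if "t > 0" for t
  proof -
    have "conv_mm G F t = transpose (conv_mm F G t)"
      using LICM by (intro conv_mm_transpose) (auto simp: LICM_def completely_monotone_def)
    then show ?thesis
      using FG[OF that] by simp
  qed
  show "AE t in lebesgue_on {0..}. J_op G (D_F F w) t = w t - w 0" if "AC w" for w
  proof -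
    obtain f where f: "locally_integrable f" and w: "\<And>t. t \<ge> 0 \<Longrightarrow> w t = w 0 + integral {0..t} f"
      using AC_imp_indefinite_integral[OF \<open>AC w\<close>] by blast
    \<comment> \<open>\<open>D_F F w\<close> is identified almost everywhere, and under the outer
      integral this gives equality at every t.\<close>
    have J: "J_op G (D_F F w) t = conv_mv G (conv_mv F f) t" for t
      unfolding J_op_def by (rule conv_mv_cong[OF D_F_AC[OF F f w]])
    have "AE t in lebesgue. t > 0 \<longrightarrow> conv_mv G (conv_mv F f) t = integral {0..t} f"
      by (rule AE_integral_eq_conv_mv[OF G F f]) (rule GF)
    then show ?thesis
      unfolding AE_lebesgue_on_nonneg_iff
    proof eventually_elim
      case (elim t)
      then show ?case
        using w[of t] by (simp add: J)
    qed
  qed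
  show "AE t in lebesgue_on {0..}. D_F F (J_op G v) t = v t" if v: "locally_integrable v" for v
  proof -
    have "AE t in lebesgue. t > 0 \<longrightarrow> conv_mv F (conv_mv G v) t = integral {0..t} v"
      by (rule AE_integral_eq_conv_mv[OF F G v]) (rule FG)
    from D_op_indefinite_integral[OF v this] show ?thesis
      unfolding AE_lebesgue_on_nonneg_iff J_op_def
      by eventually_elim (simp add: D_F_def conv_mv_0)
  qed
qed

end
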